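(* For the velocity diagram $V$, rotation diagram $C$ and translation diagram $\bar C$ associated with an infinitesimally flexible net $F(u,v)$ in isotropic space, the following properties are equivalent: (i) The infinitesimal isometry of $F$ induces an infinitesimal isometry of all transversal ruled surfaces. (ii) $V$ is a Q-net. (iii) $\bar C$ is a Q-net. (iv) The infinitesimal isometry of $C$ induces an infinitesimal isometry of all transversal ruled surfaces. (v) $LC$ is reciprocal parallel to $F$.
   Context: The top view of $(x,y,z)\in\mathbb{R}^3$ is $(x,y)$. The isotropic Gaussian curvature of a graph $z=\varphi(x,y)$ is $K=\varphi_{xx}\varphi_{yy}-\varphi_{xy}^2$; for other parametrized surfaces it is computed in local graph representations. A deformation of a surface $F$ with velocity diagram (deformation vector field) $V$ is an infinitesimal isometry if $F+\varepsilon V$ preserves, to first order at $\varepsilon=0$, the metric of the top view and the isotropic Gaussian curvature. A surface is infinitesimally flexible if a non-trivial such $V$ exists. Diagrams: the surface $F=(x,y,f(x,y))$ has velocity diagram $V=(-y,x,n(x,y))$, where $f_{xx}n_{yy}-2f_{xy}n_{xy}+f_{yy}n_{xx}=0$. The rotation diagram is $C=(-n_x,-n_y,c)$ with $c_x=f_xn_{xy}-f_yn_{xx}$, $c_y=f_xn_{yy}-f_yn_{xy}$, and the translation diagram is $\bar C=(-n_y,n_x,-n+n_xx+n_yy)$. $\bar C$ is a velocity diagram of an infinitesimal isometry of $C$; this is the infinitesimal isometry of $C$ in (iv). A net is a parametrization $F(u,v)$ of the surface, i.e. $(x,y)=(x(u,v),y(u,v))$; $V,C,\bar C$ are parametrized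 correspondingly by $(u,v)$. $L$ is the Euclidean motion $L(x,y,z)=(y,-x,-z)$. A parametrized surface $G(u,v)$ is a Q-net (conjugate net) if $G_{uv}\in\mathrm{span}(G_u,G_v)$ at each point. Transversal ruled surfaces of a net $G(u,v)$: along a $u$-parameter curve $v=v_0$ the tangents to the $v$-parameter curves form the transversal ruled surface $R(u,t)=G(u,v_0)+t\,G_v(u,v_0)$; analogously along $v$-parameter curves. If $W(u,v)$ is the velocity diagram of $G(u,v)$, the infinitesimal isometry induces an infinitesimal isometry of this ruled surface if $S(u,t)=W(u,v_0)+t\,W_v(u,v_0)$ is a velocity diagram of an infinitesimal isometry of $R(u,t)$; analogously for the other family. (Such infinitesimal isometries, in which rulings correspond to rulings, are infinitesimal Minding isometries.) Two parametrized surfaces $G(u,v),H(u,v)$ are reciprocal parallel if $G_u\parallel H_v$ and $G_v\parallel H_u$ at all points.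
   Formalization: (i)⇒(ii) and (iv)⇒(iii) are shown only if F, resp. C, is not a Q-net on any nonempty open part of the parameter domain (they fail e.g. for f=(x²+y²)/2, n=xy, u=x, v=y); C is assumed to have regular top view, so that its curvature is defined. *)

theory Defs
  imports "HOL-Analysis.Analysis"
begin

section \<open>Partial derivatives and smoothness\<close>

definition pd1 :: "(real \<times> real \<Rightarrow> 'a::real_normed_vector) \<Rightarrow> real \<times> real \<Rightarrow> 'a" where
  "pd1 g p = vector_derivative (\<lambda>s. g (s, snd p)) (at (fst p))"

definition pd2 :: "(real \<times> real \<Rightarrow> 'a::real_normed_vector) \<Rightarrow> real \<times> real \<Rightarrow> 'a" where
  "pd2 g p = vector_derivative (\<lambda>s. g (fst p, s)) (at (snd p))"

text \<open>Class \<open>C\<^sup>k\<close> and \<open>C\<^sup>\<infinity>\<close>; meant for open sets \<open>S\<close>.\<close>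

primrec Ck_on :: "nat \<Rightarrow> (real \<times> real) set \<Rightarrow> (real \<times> real \<Rightarrow> 'a::real_normed_vector) \<Rightarrow> bool" where
  "Ck_on 0 S g \<longleftrightarrow> continuous_on S g"
| "Ck_on (Suc k) S g \<longleftrightarrow>
     (\<forall>p\<in>S. g differentiable (at p)) \<and> Ck_on k S (pd1 g) \<and> Ck_on k S (pd2 g)"

definition smooth_on :: "(real \<times> real) set \<Rightarrow> (real \<times> real \<Rightarrow> 'a::real_normed_vector) \<Rightarrow> bool" where
  "smooth_on S g \<longleftrightarrow> (\<forall>k. Ck_on k S g)"


section \<open>Surfaces in isotropic space\<close>

type_synonym point = "real \<times> real \<times> real"

text \<open>A parametrized surface is a map from parameter pairs to points.\<close>

type_synonym psurf = "real \<times> real \<Rightarrow> point"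

definition top_view :: "point \<Rightarrow> real \<times> real" where
  "top_view = (\<lambda>(x, y, z). (x, y))"

definition height :: "point \<Rightarrow> real" where
  "height = (\<lambda>(x, y, z). z)"

text \<open>The top view is an immersion at the parameter \<open>p\<close> (nonzero Jacobian determinant);
  for a smooth surface this means that it is locally a graph there.\<close>

definition top_regular :: "psurf \<Rightarrow> real \<times> real \<Rightarrow> bool" where
  "top_regular X p \<longleftrightarrow>
     (let a = pd1 (top_view \<circ> X) p; b = pd2 (top_view \<circ> X) p
      in fst a * snd b - snd a * fst b \<noteq> 0)"

definition graph_curvature :: "(real \<times> real \<Rightarrow> real) \<Rightarrow> real \<times> real \<Rightarrow> real" where
  "graph_curvature \<phi> q = pd1 (pd1 \<phi>) q * pd2 (pd2 \<phi>) q - (pd2 (pd1 \<phi>) q)\<^sup>2"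

text \<open>Isotropic Gaussian curvature via a local graph representation.  At parameters where
  the surface is of class \<open>C\<^sup>2\<close> and \<open>top_regular\<close>, such a representation exists
  and its germ is unique, by the inverse function theorem.\<close>

definition has_iso_curvature :: "psurf \<Rightarrow> real \<times> real \<Rightarrow> real \<Rightarrow> bool" where
  "has_iso_curvature X p k \<longleftrightarrow>
     top_regular X p \<and>
     (\<exists>W B \<phi>. open W \<and> p \<in> W \<and> Ck_on 2 W X \<and> open B \<and> Ck_on 2 B \<phi> \<and>
        (\<forall>q\<in>W. top_view (X q) \<in> B \<and> height (X q) = \<phi> (top_view (X q))) \<and>
        k = graph_curvature \<phi> (top_view (X p)))"

definition iso_curvature :: "psurf \<Rightarrow> real \<times> real \<Rightarrow> real" where
  "iso_curvature X p = (THE k. has_iso_curvature X p k)"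

definition deform :: "psurf \<Rightarrow> psurf \<Rightarrow> real \<Rightarrow> psurf" where
  "deform X W \<epsilon> = (\<lambda>q. X q + \<epsilon> *\<^sub>R W q)"

text \<open>The coefficients of the first fundamental form of the top view are stationary at
  \<open>\<epsilon> = 0\<close>.\<close>

definition metric_preserved :: "psurf \<Rightarrow> psurf \<Rightarrow> real \<times> real \<Rightarrow> bool" where
  "metric_preserved X W p \<longleftrightarrow>
     ((\<lambda>\<epsilon>. pd1 (top_view \<circ> deform X W \<epsilon>) p \<bullet> pd1 (top_view \<circ> deform X W \<epsilon>) p)
        has_real_derivative 0) (at 0) \<and>
     ((\<lambda>\<epsilon>. pd1 (top_view \<circ> deform X W \<epsilon>) p \<bullet> pd2 (top_view \<circ> deform X W \<epsilon>) p)
        has_real_derivative 0) (at 0) \<and>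
     ((\<lambda>\<epsilon>. pd2 (top_view \<circ> deform X W \<epsilon>) p \<bullet> pd2 (top_view \<circ> deform X W \<epsilon>) p)
        has_real_derivative 0) (at 0)"

definition curvature_preserved :: "psurf \<Rightarrow> psurf \<Rightarrow> real \<times> real \<Rightarrow> bool" where
  "curvature_preserved X W p \<longleftrightarrow>
     ((\<lambda>\<epsilon>. iso_curvature (deform X W \<epsilon>) p) has_real_derivative 0) (at 0)"

text \<open>\<open>W\<close> is the velocity diagram of an infinitesimal isometry of \<open>X\<close> on the
  parameter domain \<open>D\<close>.  The curvature is undefined where the top view is singular (which
  does occur on ruled surfaces), so there only the metric condition is meaningful.\<close>

definition infinitesimal_isometry :: "(real \<times> real) set \<Rightarrow> psurf \<Rightarrow> psurf \<Rightarrow> bool" where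
  "infinitesimal_isometry D X W \<longleftrightarrow>
     (\<forall>p\<in>D. metric_preserved X W p \<and> (top_regular X p \<longrightarrow> curvature_preserved X W p))"


section \<open>Q-nets, transversal ruled surfaces, reciprocal parallelism\<close>

definition Q_net :: "(real \<times> real) set \<Rightarrow> psurf \<Rightarrow> bool" where
  "Q_net D G \<longleftrightarrow> (\<forall>p\<in>D. pd2 (pd1 G) p \<in> span {pd1 G p, pd2 G p})"

text \<open>Ruled surface along the curve \<open>v = v0\<close>, with parameters \<open>(u, t)\<close>, and ruled surface
  along the curve \<open>u = u0\<close>, with parameters \<open>(v, t)\<close>.\<close>

definition ruled_u :: "psurf \<Rightarrow> real \<Rightarrow> psurf" where
  "ruled_u G v0 = (\<lambda>(u, t). G (u, v0) + t *\<^sub>R pd2 G (u, v0))"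

definition ruled_v :: "psurf \<Rightarrow> real \<Rightarrow> psurf" where
  "ruled_v G u0 = (\<lambda>(v, t). G (u0, v) + t *\<^sub>R pd1 G (u0, v))"

text \<open>The infinitesimal isometry of the net \<open>G\<close> with velocity diagram \<open>W\<close> induces an
  infinitesimal isometry of all transversal ruled surfaces.\<close>

definition induces_ruled_isometries :: "(real \<times> real) set \<Rightarrow> psurf \<Rightarrow> psurf \<Rightarrow> bool" where
  "induces_ruled_isometries D G W \<longleftrightarrow>
     (\<forall>v0. infinitesimal_isometry {(u, t). (u, v0) \<in> D} (ruled_u G v0) (ruled_u W v0)) \<and>
     (\<forall>u0. infinitesimal_isometry {(v, t). (u0, v) \<in> D} (ruled_v G u0) (ruled_v W u0))"

text \<open>The transversal ruled surfaces of \<open>G\<close> are skew in the weak sense that they are not all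
  developable over an open piece of the net: they are developable there exactly if \<open>G\<close> is a
  Q-net there.  The curvature of such a ruled surface is
  \<open>K = - (det (G\<^sub>u, G\<^sub>v, G\<^sub>u\<^sub>v))\<^sup>2 / J\<^sup>4\<close> (with \<open>J\<close> the Jacobian of its top view), so where the
  determinant vanishes, every deformation taking rulings to rulings preserves \<open>K\<close> to first
  order, and preservation of \<open>K\<close> carries no information.\<close>

definition skew_transversals :: "(real \<times> real) set \<Rightarrow> psurf \<Rightarrow> bool" where
  "skew_transversals D G \<longleftrightarrow> (\<forall>E. open E \<and> E \<noteq> {} \<and> E \<subseteq> D \<longrightarrow> \<not> Q_net E G)"

text \<open>For nonzero \<open>a\<close> and \<open>b\<close>, collinearity of \<open>0, a, b\<close> means that \<open>a\<close> and \<open>b\<close> are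
  parallel.\<close>

definition reciprocal_parallel :: "(real \<times> real) set \<Rightarrow> psurf \<Rightarrow> psurf \<Rightarrow> bool" where
  "reciprocal_parallel D G H \<longleftrightarrow>
     (\<forall>p\<in>D. collinear {0, pd1 G p, pd2 H p} \<and> collinear {0, pd2 G p, pd1 H p})"


section \<open>The diagrams of an infinitesimally flexible graph\<close>

text \<open>All diagrams are given over the top view \<open>(x, y)\<close> of the surface; the nets arise by
  composition with \<open>(u, v) \<mapsto> (x, y)\<close>.\<close>

definition graph_surface :: "(real \<times> real \<Rightarrow> real) \<Rightarrow> psurf" where
  "graph_surface f = (\<lambda>(x, y). (x, y, f (x, y)))"

definition velocity_diagram :: "(real \<times> real \<Rightarrow> real) \<Rightarrow> psurf" where
  "velocity_diagram n = (\<lambda>(x, y). (- y, x, n (x, y)))"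

definition rotation_diagram :: "(real \<times> real \<Rightarrow> real) \<Rightarrow> (real \<times> real \<Rightarrow> real) \<Rightarrow> psurf" where
  "rotation_diagram n c = (\<lambda>p. (- pd1 n p, - pd2 n p, c p))"

definition translation_diagram :: "(real \<times> real \<Rightarrow> real) \<Rightarrow> psurf" where
  "translation_diagram n =
     (\<lambda>(x, y). (- pd2 n (x, y), pd1 n (x, y), - n (x, y) + pd1 n (x, y) * x + pd2 n (x, y) * y))"

definition flexion_equation ::
    "(real \<times> real) set \<Rightarrow> (real \<times> real \<Rightarrow> real) \<Rightarrow> (real \<times> real \<Rightarrow> real) \<Rightarrow> bool" where
  "flexion_equation U f n \<longleftrightarrow>
     (\<forall>p\<in>U. pd1 (pd1 f) p * pd2 (pd2 n) p - 2 * pd2 (pd1 f) p * pd2 (pd1 n) p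
            + pd2 (pd2 f) p * pd1 (pd1 n) p = 0)"

text \<open>The velocity diagram \<open>(-y, x, n)\<close> comes from a rigid motion of isotropic space exactly
  if \<open>n\<close> is an affine function.\<close>

definition trivial_velocity :: "(real \<times> real) set \<Rightarrow> (real \<times> real \<Rightarrow> real) \<Rightarrow> bool" where
  "trivial_velocity U n \<longleftrightarrow> (\<exists>a b d. \<forall>(x, y)\<in>U. n (x, y) = a * x + b * y + d)"

text \<open>The height \<open>c\<close> of the rotation diagram is determined up to an additive constant by its
  partial derivatives.\<close>

definition rotation_height ::
    "(real \<times> real) set \<Rightarrow> (real \<times> real \<Rightarrow> real) \<Rightarrow> (real \<times> real \<Rightarrow> real)
      \<Rightarrow> (real \<times> real \<Rightarrow> real) \<Rightarrow> bool" where
  "rotation_height U f n c \<longleftrightarrow>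
     (\<forall>p\<in>U. pd1 c p = pd1 f p * pd2 (pd1 n) p - pd2 f p * pd1 (pd1 n) p \<and>
            pd2 c p = pd1 f p * pd2 (pd2 n) p - pd2 f p * pd2 (pd1 n) p)"

definition motion_L :: "point \<Rightarrow> point" where
  "motion_L = (\<lambda>(x, y, z). (y, - x, - z))"

end

theory Submission
  imports Defs
begin

text \<open>
Each of the five properties (for the two about ruled surfaces, if these are skew) expresses the vanishing of
one function on the parameter domain, the Hessian of \<open>n\<close> polarized in the directions of the two
families of parameter curves,
\<open>h = hess_form n \<psi> (\<psi>\<^sub>u) (\<psi>\<^sub>v)\<close>.

For the nets \<open>V\<close> and \<open>C'\<close> this is a determinant computation.  A net \<open>X\<close> with regular top view is
conjugate if and only if \<open>det (X\<^sub>u, X\<^sub>v, X\<^sub>u\<^sub>v) = 0\<close>.  Up to a quarter turn the top view of \<open>V\<close> is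
\<open>\<psi>\<close> and that of \<open>C'\<close> is the gradient \<open>\<nu> = \<nabla>n \<circ> \<psi>\<close>.  In both cases the first derivatives of the
height are a linear function of those of the top view (with coefficients \<open>\<nu>\<close> and \<open>\<psi>\<close>,
respectively: the two nets are dual to each other), and the mixed second derivative deviates from
that linear function by exactly \<open>\<nu>\<^sub>u \<bullet> \<psi>\<^sub>v = h\<close>.  So both determinants are \<open>h\<close> times the nonzero
Jacobian of the top view (\<open>Q_net_over_rotated_top\<close>).  Reciprocal parallelism reduces to the same
number, since tangent vectors of \<open>F\<close> and of \<open>LC\<close> lie in the same tangent plane of the graph of \<open>f\<close>,
where being parallel is decided in the top view, and
\<open>det2 (rot90 \<nu>\<^sub>u) \<psi>\<^sub>v = - \<nu>\<^sub>u \<bullet> \<psi>\<^sub>v = - h\<close>.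

For the ruled surfaces, let \<open>G\<close> be a net whose velocity diagram \<open>W\<close> has the top view of \<open>G\<close> turned by
a right angle; \<open>(F, V)\<close> and \<open>(C, C')\<close> are such pairs.  Then \<open>G + \<epsilon> W\<close> has a top view that differs
from that of \<open>G\<close> by a similarity of ratio \<open>sqrt (1 + \<epsilon>\<^sup>2)\<close>, so the metric is always stationary at
\<open>\<epsilon> = 0\<close>.  A transversal ruled surface of \<open>G\<close> has the curvature
\<open>- (det (G\<^sub>u, G\<^sub>v, G\<^sub>u\<^sub>v))\<^sup>2 / J\<^sup>4\<close>, with \<open>J\<close> the Jacobian of its top view, and the same formula applies to
the deformed ruled surface.  Because heights are linear in \<open>\<epsilon>\<close>, the determinant becomes
\<open>(1 + \<epsilon>\<^sup>2) (det (G\<^sub>u, G\<^sub>v, G\<^sub>u\<^sub>v) + \<epsilon> det (W\<^sub>u, W\<^sub>v, W\<^sub>u\<^sub>v))\<close>, and the derivative of the curvature at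
\<open>\<epsilon> = 0\<close> is a nonzero multiple of the product of the two determinants
(\<open>ruled_surface_deformation\<close>, \<open>induces_ruled_isometries_iff\<close>).  Thus the induced isometries exist if \<open>W\<close> is
conjugate.  Conversely they force the product to vanish; where \<open>G\<close> is not conjugate on any open
piece, continuity makes the second determinant vanish everywhere.

The analytic part serves to evaluate \<open>iso_curvature\<close>, which is defined through local graph
representations: \<open>has_iso_curvature_unique\<close> computes it from any such representation by the chain
rule, and the inverse function theorem supplies one (\<open>smooth_local_inverse\<close>).
\<close>

section \<open>Partial derivatives\<close>

lemma pd_of_has_derivative:
  assumes "(g has_derivative g') (at p)"
  shows "pd1 g p = g' (1, 0)" and "pd2 g p = g' (0, 1)"
proof -
  have lin: "linear g'"
    using assms has_derivative_linear by blast
  have "((\<lambda>s. g (s, snd p)) has_derivative (\<lambda>h. g' (h, 0))) (at (fst p))"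
    by (rule has_derivative_compose[of "\<lambda>s. (s, snd p)" "\<lambda>h. (h, 0)", where g = g and g' = g'])
      (use assms in \<open>auto intro!: derivative_eq_intros\<close>)
  moreover have "(\<lambda>h. g' (h, 0)) = (\<lambda>h. h *\<^sub>R g' (1, 0))"
  proof
    show "g' (h, 0) = h *\<^sub>R g' (1, 0)" for h
      using linear_scale[OF lin, of h "(1, 0)"] by simp
  qed
  ultimately have "((\<lambda>s. g (s, snd p)) has_vector_derivative g' (1, 0)) (at (fst p))"
    by (simp only: has_vector_derivative_def)
  then show "pd1 g p = g' (1, 0)"
    by (simp add: pd1_def vector_derivative_at)
  have "((\<lambda>s. g (fst p, s)) has_derivative (\<lambda>h. g' (0, h))) (at (snd p))"
    by (rule has_derivative_compose[of "\<lambda>s. (fst p, s)" "\<lambda>h. (0, h)", where g = g and g' = g'])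
      (use assms in \<open>auto intro!: derivative_eq_intros\<close>)
  moreover have "(\<lambda>h. g' (0, h)) = (\<lambda>h. h *\<^sub>R g' (0, 1))"
  proof
    show "g' (0, h) = h *\<^sub>R g' (0, 1)" for h
      using linear_scale[OF lin, of h "(0, 1)"] by simp
  qed
  ultimately have "((\<lambda>s. g (fst p, s)) has_vector_derivative g' (0, 1)) (at (snd p))"
    by (simp only: has_vector_derivative_def)
  then show "pd2 g p = g' (0, 1)"
    by (simp add: pd2_def vector_derivative_at)
qed

text \<open>Together with the preceding lemma, this translates between partial and total derivatives: every
differentiation rule below is the rule for total derivatives evaluated at the unit vectors.\<close>

lemma has_derivative_pd:
  assumes "g differentiable (at p)"
  shows "(g has_derivative (\<lambda>h. fst h *\<^sub>R pd1 g p + snd h *\<^sub>R pd2 g p)) (at p)"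
proof -
  obtain g' where g': "(g has_derivative g') (at p)"
    using assms by (auto simp: differentiable_def)
  then have lin: "linear g'"
    using has_derivative_linear by blast
  have "g' h = fst h *\<^sub>R pd1 g p + snd h *\<^sub>R pd2 g p" for h
  proof -
    have "g' h = g' (fst h *\<^sub>R (1, 0) + snd h *\<^sub>R (0, 1))"
      by simp
    then show ?thesis
      by (simp only: linear_add[OF lin] linear_scale[OF lin] pd_of_has_derivative[OF g'])
  qed
  then have "g' = (\<lambda>h. fst h *\<^sub>R pd1 g p + snd h *\<^sub>R pd2 g p)"
    by blast
  with g' show ?thesis by simp
qed

lemma pd_linear:
  assumes "bounded_linear L" "g differentiable (at p)"
  shows "pd1 (\<lambda>q. L (g q)) p = L (pd1 g p)" and "pd2 (\<lambda>q. L (g q)) p = L (pd2 g p)"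
  using pd_of_has_derivative[OF bounded_linear.has_derivative[OF assms(1) has_derivative_pd[OF assms(2)]]]
  by simp_all

lemma pd_bilinear:
  assumes "bounded_bilinear b" "g differentiable (at p)" "h differentiable (at p)"
  shows "pd1 (\<lambda>q. b (g q) (h q)) p = b (g p) (pd1 h p) + b (pd1 g p) (h p)"
    and "pd2 (\<lambda>q. b (g q) (h q)) p = b (g p) (pd2 h p) + b (pd2 g p) (h p)"
  using pd_of_has_derivative[OF bounded_bilinear.FDERIV[OF assms(1)
        has_derivative_pd[OF assms(2)] has_derivative_pd[OF assms(3)]]]
  by simp_all

lemma pd_add:
  assumes "g differentiable (at p)" "h differentiable (at p)"
  shows "pd1 (\<lambda>q. g q + h q) p = pd1 g p + pd1 h p"
    and "pd2 (\<lambda>q. g q + h q) p = pd2 g p + pd2 h p"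
  using pd_of_has_derivative[OF has_derivative_add[OF
        has_derivative_pd[OF assms(1)] has_derivative_pd[OF assms(2)]]]
  by simp_all

lemma pd_compose:
  fixes g :: "real \<times> real \<Rightarrow> 'a::real_normed_vector"
  assumes "\<psi> differentiable (at p)" "g differentiable (at (\<psi> p))"
  shows "pd1 (\<lambda>q. g (\<psi> q)) p = fst (pd1 \<psi> p) *\<^sub>R pd1 g (\<psi> p) + snd (pd1 \<psi> p) *\<^sub>R pd2 g (\<psi> p)"
    and "pd2 (\<lambda>q. g (\<psi> q)) p = fst (pd2 \<psi> p) *\<^sub>R pd1 g (\<psi> p) + snd (pd2 \<psi> p) *\<^sub>R pd2 g (\<psi> p)"
  using pd_of_has_derivative[OF has_derivative_compose[OF
        has_derivative_pd[OF assms(1)] has_derivative_pd[OF assms(2)]]]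
  by simp_all

lemma pd_inverse:
  fixes g :: "real \<times> real \<Rightarrow> real"
  assumes "g differentiable (at p)" "g p \<noteq> 0"
  shows "pd1 (\<lambda>q. inverse (g q)) p = - (inverse (g p) * pd1 g p * inverse (g p))"
    and "pd2 (\<lambda>q. inverse (g q)) p = - (inverse (g p) * pd2 g p * inverse (g p))"
  using pd_of_has_derivative[OF Deriv.has_derivative_inverse[OF assms(2) has_derivative_pd[OF assms(1)]]]
  by simp_all

lemma pd_const [simp]: "pd1 (\<lambda>q. c) = (\<lambda>p. 0)" "pd2 (\<lambda>q. c) = (\<lambda>p. 0)"
  using pd_of_has_derivative[OF has_derivative_const[of c]] by auto

text \<open>The definitions of \<open>pd1\<close> and \<open>pd2\<close> look only at a slice through the point, so equality on a
neighbourhood suffices; this is what allows a first derivative known on an open set to be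
differentiated again.\<close>

lemma pd_cong:
  assumes "open S" "p \<in> S" "\<And>q. q \<in> S \<Longrightarrow> g q = h q"
  shows "pd1 g p = pd1 h p" and "pd2 g p = pd2 h p"
proof -
  have S: "open ((\<lambda>s. (s, snd p)) -` S)" "open ((\<lambda>s. (fst p, s)) -` S)"
    by (intro open_vimage assms continuous_intros)+
  have "\<forall>\<^sub>F s in nhds (fst p). g (s, snd p) = h (s, snd p)"
    using S(1) assms unfolding eventually_nhds
    by (intro exI[of _ "(\<lambda>s. (s, snd p)) -` S"]) auto
  then show "pd1 g p = pd1 h p"
    unfolding pd1_def by (intro vector_derivative_cong_eq) auto
  have "\<forall>\<^sub>F s in nhds (snd p). g (fst p, s) = h (fst p, s)"
    using S(2) assms unfolding eventually_nhds
    by (intro exI[of _ "(\<lambda>s. (fst p, s)) -` S"]) auto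
  then show "pd2 g p = pd2 h p"
    unfolding pd2_def by (intro vector_derivative_cong_eq) auto
qed

section \<open>Closure properties of \<open>C\<^sup>k\<close> functions\<close>

lemma differentiable_cong_on_open:
  fixes p :: "real \<times> real"
  assumes "open S" "p \<in> S" "\<And>q. q \<in> S \<Longrightarrow> g q = h q" "g differentiable (at p)"
  shows "h differentiable (at p)"
  using has_derivative_transform_within_open[OF has_derivative_pd[OF assms(4)] assms(1,2,3)]
  unfolding differentiable_def by blast

lemma Ck_on_cong:
  assumes "open S" "\<And>q. q \<in> S \<Longrightarrow> g q = h q" "Ck_on k S g"
  shows "Ck_on k S h"
  using assms(2,3)
proof (induction k arbitrary: g h)
  case 0
  then show ?case using continuous_on_cong[of S S g h] by simp
next
  case (Suc k)
  have "h differentiable (at p)" if "p \<in> S" for p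
    by (rule differentiable_cong_on_open[OF assms(1) that Suc.prems(1)]) (use Suc.prems that in auto)
  moreover have "Ck_on k S (pd1 h)"
    by (rule Suc.IH[OF pd_cong(1)[OF assms(1) _ Suc.prems(1)]]) (use Suc.prems in auto)
  moreover have "Ck_on k S (pd2 h)"
    by (rule Suc.IH[OF pd_cong(2)[OF assms(1) _ Suc.prems(1)]]) (use Suc.prems in auto)
  ultimately show ?case by simp
qed

lemma Ck_on_subset: "Ck_on k S g \<Longrightarrow> T \<subseteq> S \<Longrightarrow> Ck_on k T g"
  by (induction k arbitrary: g) (auto intro: continuous_on_subset)

text \<open>The induction step of all closure properties: the partial derivatives need only be identified on the open
set, where they are given by a differentiation rule.\<close>

lemma Ck_on_SucI:
  assumes "open S" "\<And>p. p \<in> S \<Longrightarrow> g differentiable (at p)"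
    and "\<And>p. p \<in> S \<Longrightarrow> pd1 g p = g1 p" "\<And>p. p \<in> S \<Longrightarrow> pd2 g p = g2 p"
    and "Ck_on k S g1" "Ck_on k S g2"
  shows "Ck_on (Suc k) S g"
  using assms Ck_on_cong[of S g1 "pd1 g" k] Ck_on_cong[of S g2 "pd2 g" k] by simp

lemma Ck_on_Suc_D: "Ck_on (Suc k) S g \<Longrightarrow> Ck_on k S g"
proof (induction k arbitrary: g)
  case 0
  then show ?case
    by (auto intro!: continuous_at_imp_continuous_on differentiable_imp_continuous_within)
next
  case (Suc k)
  from Suc.prems have "\<forall>p\<in>S. g differentiable (at p)"
    "Ck_on (Suc k) S (pd1 g)" "Ck_on (Suc k) S (pd2 g)"
    unfolding Ck_on.simps(2)[of "Suc k"] by blast+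
  with Suc.IH show ?case
    unfolding Ck_on.simps(2)[of k S g] by blast
qed

lemma Ck_on_const: "Ck_on k S (\<lambda>p. c)"
  by (induction k arbitrary: c) auto

lemma Ck_on_linear:
  assumes L: "bounded_linear L" and "open S" "Ck_on k S g"
  shows "Ck_on k S (\<lambda>p. L (g p))"
  using assms(3)
proof (induction k arbitrary: g)
  case 0
  then show ?case
    by (simp add: bounded_linear.continuous_on[OF L])
next
  case (Suc k)
  then have d: "g differentiable (at p)" if "p \<in> S" for p
    using that by simp
  show ?case
  proof (rule Ck_on_SucI[OF \<open>open S\<close> _ pd_linear[OF L d]])
    show "(\<lambda>p. L (g p)) differentiable (at p)" if "p \<in> S" for p
      using bounded_linear.has_derivative[OF L has_derivative_pd[OF d[OF that]]]
      unfolding differentiable_def by blast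
  qed (use Suc.prems in \<open>auto intro!: Suc.IH\<close>)
qed

lemma Ck_on_add:
  assumes "open S" "Ck_on k S g" "Ck_on k S h"
  shows "Ck_on k S (\<lambda>p. g p + h p)"
  using assms(2,3)
proof (induction k arbitrary: g h)
  case 0
  then show ?case by (simp add: continuous_on_add)
next
  case (Suc k)
  then have d: "g differentiable (at p)" "h differentiable (at p)" if "p \<in> S" for p
    using that by simp_all
  show ?case
    by (rule Ck_on_SucI[OF \<open>open S\<close> _ pd_add[OF d]])
      (use Suc.prems d in \<open>auto intro!: Suc.IH\<close>)
qed

lemma Ck_on_bilinear:
  assumes b: "bounded_bilinear b" and "open S" "Ck_on k S g" "Ck_on k S h"
  shows "Ck_on k S (\<lambda>p. b (g p) (h p))"
  using assms(3,4)
proof (induction k arbitrary: g h)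
  case 0
  then show ?case by (simp add: bounded_bilinear.continuous_on[OF b])
next
  case (Suc k)
  then have d: "g differentiable (at p)" "h differentiable (at p)" if "p \<in> S" for p
    using that by simp_all
  have gh: "Ck_on k S g" "Ck_on k S h"
    using Suc.prems Ck_on_Suc_D by blast+
  show ?case
  proof (rule Ck_on_SucI[OF \<open>open S\<close> _ pd_bilinear[OF b d]])
    show "(\<lambda>p. b (g p) (h p)) differentiable (at p)" if "p \<in> S" for p
      using bounded_bilinear.FDERIV[OF b has_derivative_pd has_derivative_pd] d[OF that]
      unfolding differentiable_def by blast
  qed (use Suc.prems gh in \<open>auto intro!: Ck_on_add Suc.IH \<open>open S\<close>\<close>)
qed

lemma Ck_on_compose:
  fixes g :: "real \<times> real \<Rightarrow> 'a::real_normed_vector"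
  assumes "open S" "Ck_on k S \<psi>" "\<psi> ` S \<subseteq> T" "Ck_on k T g"
  shows "Ck_on k S (\<lambda>p. g (\<psi> p))"
  using assms(2,3,4)
proof (induction k arbitrary: g)
  case 0
  then show ?case by (auto intro: continuous_on_compose2)
next
  case (Suc k)
  then have d: "\<psi> differentiable (at p)" "g differentiable (at (\<psi> p))" if "p \<in> S" for p
    using that by auto
  have \<psi>: "Ck_on k S \<psi>" "Ck_on k S (pd1 \<psi>)" "Ck_on k S (pd2 \<psi>)"
    using Ck_on_Suc_D[OF Suc.prems(1)] Suc.prems(1) by simp_all
  have c: "Ck_on k S (\<lambda>p. pd1 g (\<psi> p))" "Ck_on k S (\<lambda>p. pd2 g (\<psi> p))"
    using Suc.prems \<psi>(1) by (auto intro!: Suc.IH)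
  show ?case
  proof (rule Ck_on_SucI[OF \<open>open S\<close> _ pd_compose[OF d]])
    show "(\<lambda>p. g (\<psi> p)) differentiable (at p)" if "p \<in> S" for p
      using has_derivative_compose[OF has_derivative_pd has_derivative_pd] d[OF that]
      unfolding differentiable_def by blast
  qed (use \<psi> c in \<open>auto intro!: Ck_on_add Ck_on_bilinear[OF bounded_bilinear_scaleR]
        Ck_on_linear[OF bounded_linear_fst] Ck_on_linear[OF bounded_linear_snd] \<open>open S\<close>\<close>)
qed

lemma Ck_on_Pair:
  assumes "open S" "Ck_on k S g" "Ck_on k S h"
  shows "Ck_on k S (\<lambda>p. (g p, h p))"
proof -
  have "bounded_linear (\<lambda>x::'a. (x, 0::'b))" "bounded_linear (\<lambda>y::'b. (0::'a, y))"
    by (intro bounded_linear_intros bounded_linear_Pair bounded_linear_zero bounded_linear_ident)+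
  from Ck_on_add[OF assms(1) Ck_on_linear[OF this(1) assms(1,2)] Ck_on_linear[OF this(2) assms(1,3)]]
  show ?thesis by simp
qed

lemma Ck_on_inverse:
  fixes g :: "real \<times> real \<Rightarrow> real"
  assumes "open S" "Ck_on k S g" "\<And>p. p \<in> S \<Longrightarrow> g p \<noteq> 0"
  shows "Ck_on k S (\<lambda>p. inverse (g p))"
  using assms(2)
proof (induction k)
  case 0
  then show ?case using assms by (auto intro!: continuous_intros)
next
  case (Suc k)
  then have d: "g differentiable (at p)" if "p \<in> S" for p
    using that by simp
  have i: "Ck_on k S (\<lambda>p. inverse (g p))"
    using Suc Ck_on_Suc_D by blast
  show ?case
  proof (rule Ck_on_SucI[OF \<open>open S\<close> _ pd_inverse[OF d assms(3)]])
    show "(\<lambda>p. inverse (g p)) differentiable (at p)" if "p \<in> S" for p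
      using Deriv.has_derivative_inverse[OF assms(3)[OF that] has_derivative_pd[OF d[OF that]]]
      unfolding differentiable_def by blast
  qed (use Suc.prems i in \<open>auto intro!: Ck_on_linear[OF bounded_linear_minus[OF bounded_linear_ident]]
        Ck_on_bilinear[OF bounded_bilinear_mult] \<open>open S\<close>\<close>)
qed

section \<open>Symmetry of mixed partial derivatives\<close>

text \<open>The classical argument for the theorem of Schwarz: the second difference over a square is
evaluated by applying the mean value theorem first to the difference of two horizontal sections and then
to \<open>pd1 g\<close> on a vertical segment.\<close>

lemma mixed_partial_mean_value:
  fixes g :: "real \<times> real \<Rightarrow> real"
  assumes "0 < h" and box: "{a..a+h} \<times> {b..b+h} \<subseteq> S" and g: "Ck_on 2 S g"
  obtains q where "q \<in> {a..a+h} \<times> {b..b+h}"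
    "g (a+h, b+h) - g (a+h, b) - g (a, b+h) + g (a, b) = h * h * pd2 (pd1 g) q"
proof -
  have d: "g differentiable (at p)" "pd1 g differentiable (at p)" if "p \<in> S" for p
    using g that by (simp_all add: numeral_2_eq_2)
  have s1: "((\<lambda>s. g (s, y)) has_real_derivative pd1 g (x, y)) (at x)"
    if "(x, y) \<in> S" for x y
  proof -
    have "((\<lambda>s. (s, y)) has_derivative (\<lambda>s. (s, 0))) (at x)"
      by (auto intro!: derivative_eq_intros)
    from has_derivative_compose[OF this has_derivative_pd[OF d(1)[OF that]]] show ?thesis
      by (simp add: has_real_derivative_iff_has_vector_derivative has_vector_derivative_def)
  qed
  have s2: "((\<lambda>s. pd1 g (x, s)) has_real_derivative pd2 (pd1 g) (x, y)) (at y)"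
    if "(x, y) \<in> S" for x y
  proof -
    have "((\<lambda>s. (x, s)) has_derivative (\<lambda>s. (0, s))) (at y)"
      by (auto intro!: derivative_eq_intros)
    from has_derivative_compose[OF this has_derivative_pd[OF d(2)[OF that]]] show ?thesis
      by (simp add: has_real_derivative_iff_has_vector_derivative has_vector_derivative_def)
  qed
  have "\<exists>x>a. x < a + h \<and> (g (a+h, b+h) - g (a+h, b)) - (g (a, b+h) - g (a, b))
        = (a + h - a) * (pd1 g (x, b+h) - pd1 g (x, b))"
    by (rule MVT2) (use \<open>0 < h\<close> box in \<open>auto intro!: derivative_intros s1\<close>)
  then obtain x where x: "a < x" "x < a + h"
    "(g (a+h, b+h) - g (a+h, b)) - (g (a, b+h) - g (a, b)) = h * (pd1 g (x, b+h) - pd1 g (x, b))"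
    by auto
  have "\<exists>y>b. y < b + h \<and> pd1 g (x, b+h) - pd1 g (x, b) = (b + h - b) * pd2 (pd1 g) (x, y)"
    by (rule MVT2) (use \<open>0 < h\<close> box x in \<open>auto intro!: derivative_intros s2\<close>)
  then obtain y where "b < y" "y < b + h"
    "pd1 g (x, b+h) - pd1 g (x, b) = h * pd2 (pd1 g) (x, y)"
    by auto
  with x show thesis
    by (intro that[of "(x, y)"]) auto
qed


lemma pd_swap:
  fixes g :: "real \<times> real \<Rightarrow> 'a::real_normed_vector"
  shows "pd1 (\<lambda>q. g (snd q, fst q)) = (\<lambda>q. pd2 g (snd q, fst q))"
    and "pd2 (\<lambda>q. g (snd q, fst q)) = (\<lambda>q. pd1 g (snd q, fst q))"
  by (auto simp: pd1_def pd2_def)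

lemma Ck_on_bounded_linear:
  fixes L :: "real \<times> real \<Rightarrow> 'a::real_normed_vector"
  assumes L: "bounded_linear L" and "open S"
  shows "Ck_on k S L"
proof (cases k)
  case 0
  then show ?thesis by (simp add: linear_continuous_on[OF L])
next
  case (Suc k')
  note D = bounded_linear_imp_has_derivative[OF L]
  show ?thesis
    unfolding Suc
    by (rule Ck_on_SucI[OF \<open>open S\<close> _ pd_of_has_derivative[OF D] Ck_on_const Ck_on_const])
      (use D in \<open>auto simp: differentiable_def\<close>)
qed

text \<open>The second difference over a square is symmetric in the two coordinates.  Evaluating it for \<open>g\<close>
and for \<open>g\<close> with swapped arguments gives a value of each mixed derivative at points near \<open>p\<close>;
these values agree, and continuity carries the equality to \<open>p\<close>.\<close>

lemma mixed_partials_commute_real: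
  fixes g :: "real \<times> real \<Rightarrow> real"
  assumes S: "open S" "p \<in> S" and g: "Ck_on 2 S g"
  shows "pd2 (pd1 g) p = pd1 (pd2 g) p"
proof (rule ccontr)
  let ?A = "pd2 (pd1 g)" and ?B = "pd1 (pd2 g)"
  assume neq: "?A p \<noteq> ?B p"
  define e where "e = \<bar>?A p - ?B p\<bar> / 2"
  have "e > 0" using neq by (simp add: e_def)
  have "isCont ?A p" "isCont ?B p"
    using g S by (auto simp: numeral_2_eq_2 continuous_on_eq_continuous_at)
  then obtain d1 d2 where d1: "d1 > 0" "\<And>q. dist q p < d1 \<Longrightarrow> dist (?A q) (?A p) < e"
    and d2: "d2 > 0" "\<And>q. dist q p < d2 \<Longrightarrow> dist (?B q) (?B p) < e"
    using \<open>e > 0\<close> unfolding continuous_at_eps_delta by metis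
  obtain d3 where d3: "d3 > 0" "ball p d3 \<subseteq> S"
    using S open_contains_ball by blast
  \<comment> \<open>A square of side \<open>h\<close> has diameter at most \<open>2 * h\<close>, which must stay below all three radii.\<close>
  define h where "h = min d1 (min d2 d3) / 3"
  have h: "h > 0" "2 * h < d1" "2 * h < d2" "2 * h < d3"
    using d1(1) d2(1) d3(1) unfolding h_def by linarith+
  obtain a b where p: "p = (a, b)" by fastforce
  have near: "dist q p \<le> 2 * h" if "q \<in> {a..a+h} \<times> {b..b+h}" for q
  proof -
    have "dist q p \<le> dist (fst q) a + dist (snd q) b"
      unfolding p dist_prod_def by (auto intro: sqrt_sum_squares_le_sum)
    also have "\<dots> \<le> h + h"
      using that by (intro add_mono) (auto simp: dist_real_def)
    finally show ?thesis by simp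
  qed
  have box: "{a..a+h} \<times> {b..b+h} \<subseteq> S"
    using near h(4) d3(2) by (force simp: dist_commute)
  obtain q where q: "q \<in> {a..a+h} \<times> {b..b+h}"
    "g (a+h, b+h) - g (a+h, b) - g (a, b+h) + g (a, b) = h * h * ?A q"
    using mixed_partial_mean_value[OF h(1) box g] .
  define S' where "S' = (\<lambda>q. (snd q, fst q)) -` S"
  have S': "open S'"
    unfolding S'_def by (intro open_vimage S continuous_intros)
  have "bounded_linear (\<lambda>q::real \<times> real. (snd q, fst q))"
    by (intro bounded_linear_intros bounded_linear_Pair bounded_linear_fst bounded_linear_snd)
  then have g': "Ck_on 2 S' (\<lambda>q. g (snd q, fst q))"
    by (intro Ck_on_compose[OF S' Ck_on_bounded_linear[OF _ S'] _ g]) (auto simp: S'_def)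
  have box': "{b..b+h} \<times> {a..a+h} \<subseteq> S'"
    using box by (auto simp: S'_def)
  obtain r where r: "r \<in> {b..b+h} \<times> {a..a+h}"
    "g (a+h, b+h) - g (a, b+h) - g (a+h, b) + g (a, b) = h * h * ?B (snd r, fst r)"
    using mixed_partial_mean_value[OF h(1) box' g'] unfolding pd_swap by auto
  have "?A q = ?B (snd r, fst r)"
    using q(2) r(2) h(1) by (simp add: algebra_simps)
  moreover have "dist (?A q) (?A p) < e"
    by (rule d1(2)[OF le_less_trans[OF near[OF q(1)] h(2)]])
  moreover have "dist (?B (snd r, fst r)) (?B p) < e"
    by (rule d2(2)[OF le_less_trans[OF near h(3)]]) (use r(1) in auto)
  ultimately show False
    unfolding e_def dist_real_def by (simp add: abs_if split: if_splits)
qed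

text \<open>Coordinates in a basis reduce the vector-valued case to the scalar one.\<close>

lemma mixed_partials_commute:
  fixes g :: "real \<times> real \<Rightarrow> 'a::euclidean_space"
  assumes S: "open S" "p \<in> S" and g: "Ck_on 2 S g"
  shows "pd2 (pd1 g) p = pd1 (pd2 g) p"
proof (rule euclidean_eqI)
  fix b :: 'a
  let ?L = "\<lambda>x. x \<bullet> b"
  have L: "bounded_linear ?L"
    by (rule bounded_linear_inner_left)
  have d: "g differentiable (at q)" "pd1 g differentiable (at q)" "pd2 g differentiable (at q)"
    if "q \<in> S" for q
    using g that by (simp_all add: numeral_2_eq_2)
  have "pd2 (pd1 (\<lambda>q. g q \<bullet> b)) p = pd2 (pd1 g) p \<bullet> b"
    using pd_cong(2)[OF S pd_linear(1)[OF L d(1)]] pd_linear(2)[OF L d(2)[OF S(2)]] by simp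
  moreover have "pd1 (pd2 (\<lambda>q. g q \<bullet> b)) p = pd1 (pd2 g) p \<bullet> b"
    using pd_cong(1)[OF S pd_linear(2)[OF L d(1)]] pd_linear(1)[OF L d(3)[OF S(2)]] by simp
  ultimately show "pd2 (pd1 g) p \<bullet> b = pd1 (pd2 g) p \<bullet> b"
    using mixed_partials_commute_real[OF S Ck_on_linear[OF L S(1) g]] by simp
qed

section \<open>Smooth functions\<close>

lemma smooth_on_imp_Ck_on: "smooth_on S g \<Longrightarrow> Ck_on k S g"
  by (simp add: smooth_on_def)

lemma smooth_on_differentiable: "smooth_on S g \<Longrightarrow> p \<in> S \<Longrightarrow> g differentiable (at p)"
  using smooth_on_imp_Ck_on[of S g "Suc 0"] by simp

lemma smooth_on_pd:
  assumes "smooth_on S g"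
  shows "smooth_on S (pd1 g)" "smooth_on S (pd2 g)"
  using assms Ck_on.simps(2) unfolding smooth_on_def by blast+

lemma smooth_on_subset: "smooth_on S g \<Longrightarrow> T \<subseteq> S \<Longrightarrow> smooth_on T g"
  unfolding smooth_on_def using Ck_on_subset by blast

lemma smooth_on_bounded_linear:
  fixes L :: "real \<times> real \<Rightarrow> 'a::real_normed_vector"
  assumes "open S" "bounded_linear L"
  shows "smooth_on S L"
  using assms Ck_on_bounded_linear unfolding smooth_on_def by blast

lemma smooth_on_const: "smooth_on S (\<lambda>p. c)"
  by (simp add: smooth_on_def Ck_on_const)

lemma smooth_on_linear:
  assumes "open S" "bounded_linear L" "smooth_on S g"
  shows "smooth_on S (\<lambda>p. L (g p))"
  using assms Ck_on_linear unfolding smooth_on_def by blast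

lemma smooth_on_add:
  assumes "open S" "smooth_on S g" "smooth_on S h"
  shows "smooth_on S (\<lambda>p. g p + h p)"
  using assms unfolding smooth_on_def by (blast intro: Ck_on_add)

lemma smooth_on_bilinear:
  assumes "open S" "bounded_bilinear b" "smooth_on S g" "smooth_on S h"
  shows "smooth_on S (\<lambda>p. b (g p) (h p))"
  using assms unfolding smooth_on_def by (blast intro: Ck_on_bilinear)

lemmas smooth_on_scaleR = smooth_on_bilinear[OF _ bounded_bilinear_scaleR]
lemmas smooth_on_mult = smooth_on_bilinear[OF _ bounded_bilinear_mult]

lemma smooth_on_compose:
  fixes g :: "real \<times> real \<Rightarrow> 'a::real_normed_vector"
  assumes "open S" "smooth_on S \<psi>" "\<psi> ` S \<subseteq> T" "smooth_on T g"
  shows "smooth_on S (\<lambda>p. g (\<psi> p))"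
  using assms unfolding smooth_on_def by (blast intro: Ck_on_compose)

lemma smooth_on_Pair:
  assumes "open S" "smooth_on S g" "smooth_on S h"
  shows "smooth_on S (\<lambda>p. (g p, h p))"
  using assms unfolding smooth_on_def by (blast intro: Ck_on_Pair)

lemma smooth_on_inverse:
  fixes g :: "real \<times> real \<Rightarrow> real"
  assumes "open S" "smooth_on S g" "\<And>p. p \<in> S \<Longrightarrow> g p \<noteq> 0"
  shows "smooth_on S (\<lambda>p. inverse (g p))"
  using assms unfolding smooth_on_def by (blast intro: Ck_on_inverse)

lemma smooth_on_uminus:
  fixes g :: "real \<times> real \<Rightarrow> 'a::real_normed_vector"
  assumes "open S" "smooth_on S g"
  shows "smooth_on S (\<lambda>p. - g p)"
  using smooth_on_linear[OF assms(1) bounded_linear_minus[OF bounded_linear_ident] assms(2)] .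

lemma smooth_on_fst_snd:
  assumes "open S" "smooth_on S g"
  shows "smooth_on S (\<lambda>p. fst (g p))" "smooth_on S (\<lambda>p. snd (g p))"
  using smooth_on_linear[OF assms(1) bounded_linear_fst assms(2)]
    smooth_on_linear[OF assms(1) bounded_linear_snd assms(2)] by simp_all

lemmas smooth_on_intros = smooth_on_const smooth_on_add smooth_on_mult smooth_on_scaleR
  smooth_on_Pair smooth_on_inverse smooth_on_uminus smooth_on_fst_snd smooth_on_pd

section \<open>Smooth local inverses in the plane\<close>

definition det2 :: "real \<times> real \<Rightarrow> real \<times> real \<Rightarrow> real" where
  "det2 a b = fst a * snd b - snd a * fst b"

text \<open>A linear map of the plane as a bounded linear function, in terms of the images \<open>a x\<close> and \<open>b x\<close> of the unit
vectors; the form in which the inverse function theorem needs the total derivative.\<close>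

lemma continuous_on_Pair_blinfun:
  fixes a b :: "real \<times> real \<Rightarrow> 'a::real_normed_vector"
  assumes "continuous_on S a" "continuous_on S b"
  shows "continuous_on S (\<lambda>x. (blinfun_scaleR_left (a x) o\<^sub>L fst_blinfun)
    + (blinfun_scaleR_left (b x) o\<^sub>L snd_blinfun) :: (real \<times> real) \<Rightarrow>\<^sub>L 'a)"
  using assms
  by (intro continuous_intros bounded_linear.continuous_on[OF bounded_linear_blinfun_scaleR_left]
      bounded_bilinear.continuous_on[OF bounded_bilinear_blinfun_compose])

text \<open>The inverse function theorem yields a differentiable inverse \<open>g\<close>.  Its smoothness follows by
induction from Cramer's rule, which writes the partial derivatives of \<open>g\<close> as smooth functions composed with \<open>g\<close>: if \<open>g\<close>
is \<open>C\<^sup>k\<close>, so are its partial derivatives.\<close>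

lemma smooth_local_inverse:
  fixes T :: "real \<times> real \<Rightarrow> real \<times> real"
  assumes "open W0" "p \<in> W0" and T: "smooth_on W0 T" and det: "det2 (pd1 T p) (pd2 T p) \<noteq> 0"
  obtains W B g where "open W" "p \<in> W" "W \<subseteq> W0" "open B" "T ` W \<subseteq> B" "g ` B \<subseteq> W"
    "smooth_on B g" "\<And>q. q \<in> W \<Longrightarrow> g (T q) = q"
proof -
  let ?j = "\<lambda>q. det2 (pd1 T q) (pd2 T q)"
  define T' :: "real \<times> real \<Rightarrow> (real \<times> real) \<Rightarrow>\<^sub>L (real \<times> real)" where
    "T' q = (blinfun_scaleR_left (pd1 T q) o\<^sub>L fst_blinfun)
          + (blinfun_scaleR_left (pd2 T q) o\<^sub>L snd_blinfun)" for q
  have T'_apply: "blinfun_apply (T' q) h = fst h *\<^sub>R pd1 T q + snd h *\<^sub>R pd2 T q" for q h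
    by (simp add: T'_def blinfun.add_left)
  have der: "(T has_derivative blinfun_apply (T' q)) (at q)" if "q \<in> W0" for q
    using has_derivative_pd[OF smooth_on_differentiable[OF T that]]
    by (simp add: T'_apply[abs_def])
  have cont: "continuous_on W0 (pd1 T)" "continuous_on W0 (pd2 T)"
    using smooth_on_pd[OF T, THEN smooth_on_imp_Ck_on, of 0] by simp_all
  have contT': "continuous_on W0 T'"
    unfolding T'_def by (rule continuous_on_Pair_blinfun[OF cont])
  define I :: "(real \<times> real) \<Rightarrow>\<^sub>L (real \<times> real)" where
    "I = (blinfun_scaleR_left (inverse (?j p) *\<^sub>R (snd (pd2 T p), - snd (pd1 T p))) o\<^sub>L fst_blinfun)
       + (blinfun_scaleR_left (inverse (?j p) *\<^sub>R (- fst (pd2 T p), fst (pd1 T p))) o\<^sub>L snd_blinfun)"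
  have I: "I o\<^sub>L T' p = id_blinfun"
  proof (rule blinfun_eqI)
    fix h
    obtain a b c d where ab: "pd1 T p = (a, b)" "pd2 T p = (c, d)" by fastforce
    have "a * d - b * c \<noteq> 0" using det by (simp add: ab det2_def)
    then show "blinfun_apply (I o\<^sub>L T' p) h = blinfun_apply id_blinfun h"
      by (simp add: I_def T'_apply blinfun.add_left ab det2_def prod_eq_iff divide_simps)
        (simp add: algebra_simps)
  qed
  obtain W B g g' where W: "open W" "W \<subseteq> W0" "p \<in> W" "open B" "T p \<in> B" "homeomorphism W B T g"
    and g': "\<And>y. y \<in> B \<Longrightarrow> (g has_derivative g' y) (at y)"
      "\<And>y. y \<in> B \<Longrightarrow> g' y = inv (blinfun_apply (T' (g y)))"
      "\<And>y. y \<in> B \<Longrightarrow> bij (blinfun_apply (T' (g y)))"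
    using inverse_function_theorem[OF \<open>open W0\<close> der contT' \<open>p \<in> W0\<close> I] by metis
  have gB: "g ` B = W" and TW: "T ` W = B" and gT: "\<And>q. q \<in> W \<Longrightarrow> g (T q) = q"
    using W(6) by (auto simp: homeomorphism_def)
  have j: "?j q \<noteq> 0" if q: "q \<in> W" for q
  proof
    assume 0: "?j q = 0"
    obtain y where y: "y \<in> B" "q = g y" using gB q by blast
    have inj: "h = 0" if "blinfun_apply (T' q) h = 0" for h
      using bij_is_inj[OF g'(3)[OF y(1)]] y(2) that blinfun.zero_right injD by metis
    have "(snd (pd2 T q), - snd (pd1 T q)) = 0" "(fst (pd2 T q), - fst (pd1 T q)) = 0"
      by (rule inj, use 0 in \<open>simp add: T'_apply det2_def prod_eq_iff algebra_simps\<close>)+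
    then have "pd1 T q = 0"
      by (auto simp: prod_eq_iff zero_prod_def)
    then have "(1::real, 0::real) = 0"
      by - (rule inj, simp add: T'_apply)
    then show False by (simp add: zero_prod_def)
  qed
  \<comment> \<open>The columns of the inverse Jacobian matrix, as functions of \<open>g y\<close> rather than \<open>y\<close>.\<close>
  define a1 a2 where "a1 = (\<lambda>q. inverse (?j q) *\<^sub>R (snd (pd2 T q), - snd (pd1 T q)))"
    and "a2 = (\<lambda>q. inverse (?j q) *\<^sub>R (- fst (pd2 T q), fst (pd1 T q)))"
  have T'a: "blinfun_apply (T' q) (a1 q) = (1, 0)" "blinfun_apply (T' q) (a2 q) = (0, 1)"
    if "q \<in> W" for q
    using j[OF that] unfolding T'_apply a1_def a2_def det2_def
    by (simp_all add: prod_eq_iff divide_simps)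
  have pdg: "pd1 g y = a1 (g y)" "pd2 g y = a2 (g y)" if "y \<in> B" for y
    using pd_of_has_derivative[OF g'(1)[OF that]] T'a[of "g y"] g'(2,3)[OF that] gB that
    by (auto intro: inv_f_eq[OF bij_is_inj])
  have TW': "smooth_on W T" using smooth_on_subset[OF T W(2)] .
  have j': "smooth_on W (\<lambda>q. inverse (?j q))"
  proof (rule smooth_on_inverse[OF W(1) _ j])
    have "smooth_on W (\<lambda>q. fst (pd1 T q) * snd (pd2 T q) + - (snd (pd1 T q) * fst (pd2 T q)))"
      by (intro smooth_on_intros W TW')
    then show "smooth_on W ?j" by (simp add: det2_def)
  qed 
  have a: "smooth_on W a1" "smooth_on W a2"
    unfolding a1_def a2_def by (intro smooth_on_intros W TW' j')+
  have "Ck_on k B g" for k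
  proof (induction k)
    case 0
    then show ?case using W(6) by (simp add: homeomorphism_def)
  next
    case (Suc k)
    show ?case
    proof (rule Ck_on_SucI[OF W(4) _ pdg])
      show "g differentiable (at y)" if "y \<in> B" for y
        using g'(1)[OF that] by (auto simp: differentiable_def)
      show "Ck_on k B (\<lambda>y. a1 (g y))" "Ck_on k B (\<lambda>y. a2 (g y))"
        by (rule Ck_on_compose[OF W(4) Suc.IH _ smooth_on_imp_Ck_on[OF a(1)]], use gB in simp)
          (rule Ck_on_compose[OF W(4) Suc.IH _ smooth_on_imp_Ck_on[OF a(2)]], use gB in simp)
    qed
  qed
  then have "smooth_on B g" by (simp add: smooth_on_def)
  show thesis
    by (rule that[OF W(1,3,2,4) _ _ \<open>smooth_on B g\<close> gT]) (simp_all add: TW gB)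
qed


section \<open>Curvature in arbitrary parameters\<close>

text \<open>The determinant of three vectors, expanded along the heights: top views and heights
transform differently under the deformations below.\<close>

definition det3 :: "point \<Rightarrow> point \<Rightarrow> point \<Rightarrow> real" where
  "det3 a b c = det2 (top_view b) (top_view c) * height a
     - det2 (top_view a) (top_view c) * height b + det2 (top_view a) (top_view b) * height c"

lemma top_view_height_simps:
  "top_view p = (fst p, fst (snd p))" "height p = snd (snd p)" for p
  by (simp_all add: top_view_def height_def split: prod.split)

lemma bounded_linear_top_view_height:
  "bounded_linear top_view" "bounded_linear height"
  unfolding top_view_height_simps[abs_def]
  by (intro bounded_linear_intros bounded_linear_Pair bounded_linear_compose[OF bounded_linear_fst]
      bounded_linear_compose[OF bounded_linear_snd] bounded_linear_fst bounded_linear_snd)+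

text \<open>The second differential of \<open>g\<close> at \<open>q\<close> as a symmetric bilinear form.\<close>

definition hess_form ::
    "(real \<times> real \<Rightarrow> real) \<Rightarrow> real \<times> real \<Rightarrow> real \<times> real \<Rightarrow> real \<times> real \<Rightarrow> real" where
  "hess_form g q a b = pd1 (pd1 g) q * (fst a * fst b)
     + pd2 (pd1 g) q * (fst a * snd b + snd a * fst b) + pd2 (pd2 g) q * (snd a * snd b)"

definition gradient :: "(real \<times> real \<Rightarrow> real) \<Rightarrow> real \<times> real \<Rightarrow> real \<times> real" where
  "gradient g q = (pd1 g q, pd2 g q)"

lemma hess_form_commute: "hess_form g q a b = hess_form g q b a"
  by (simp add: hess_form_def algebra_simps)

lemma pd_compose_gradient:
  assumes "\<psi> differentiable (at p)" "g differentiable (at (\<psi> p))"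
  shows "pd1 (\<lambda>q. g (\<psi> q)) p = gradient g (\<psi> p) \<bullet> pd1 \<psi> p"
    and "pd2 (\<lambda>q. g (\<psi> q)) p = gradient g (\<psi> p) \<bullet> pd2 \<psi> p"
  by (simp_all add: pd_compose[OF assms] gradient_def inner_prod_def)

text \<open>The Hessian is the derivative of the gradient; the symmetry of mixed derivatives enters here.\<close>

lemma pd_gradient_compose:
  assumes B: "open B" "Ck_on 2 B g" "\<psi> p \<in> B" and \<psi>: "\<psi> differentiable (at p)"
  shows "(\<lambda>q. gradient g (\<psi> q)) differentiable (at p)"
    and "pd1 (\<lambda>q. gradient g (\<psi> q)) p \<bullet> b = hess_form g (\<psi> p) (pd1 \<psi> p) b"
    and "pd2 (\<lambda>q. gradient g (\<psi> q)) p \<bullet> b = hess_form g (\<psi> p) (pd2 \<psi> p) b"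
proof -
  have d: "pd1 g differentiable (at (\<psi> p))" "pd2 g differentiable (at (\<psi> p))"
    using B by (simp_all add: numeral_2_eq_2)
  note D = has_derivative_Pair[OF
      has_derivative_compose[OF has_derivative_pd[OF \<psi>] has_derivative_pd[OF d(1)]]
      has_derivative_compose[OF has_derivative_pd[OF \<psi>] has_derivative_pd[OF d(2)]]]
  note sym = mixed_partials_commute[OF B(1,3,2)]
  show "(\<lambda>q. gradient g (\<psi> q)) differentiable (at p)"
    using D unfolding differentiable_def gradient_def by blast
  show "pd1 (\<lambda>q. gradient g (\<psi> q)) p \<bullet> b = hess_form g (\<psi> p) (pd1 \<psi> p) b"
    using pd_of_has_derivative(1)[OF D]
    by (simp add: gradient_def hess_form_def inner_prod_def sym algebra_simps)
  show "pd2 (\<lambda>q. gradient g (\<psi> q)) p \<bullet> b = hess_form g (\<psi> p) (pd2 \<psi> p) b"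
    using pd_of_has_derivative(2)[OF D]
    by (simp add: gradient_def hess_form_def inner_prod_def sym algebra_simps)
qed

lemma pd_gradient_inner:
  assumes "open B" "Ck_on 2 B g" "\<psi> p \<in> B" and "\<psi> differentiable (at p)"
    and a: "a differentiable (at p)"
  shows "pd1 (\<lambda>q. gradient g (\<psi> q) \<bullet> a q) p
      = hess_form g (\<psi> p) (a p) (pd1 \<psi> p) + gradient g (\<psi> p) \<bullet> pd1 a p"
    and "pd2 (\<lambda>q. gradient g (\<psi> q) \<bullet> a q) p
      = hess_form g (\<psi> p) (a p) (pd2 \<psi> p) + gradient g (\<psi> p) \<bullet> pd2 a p"
  using pd_bilinear[OF bounded_bilinear_inner pd_gradient_compose(1)[OF assms(1-4)] a]
  by (simp_all add: pd_gradient_compose[OF assms(1-4)] hess_form_commute[of _ _ "a p"])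

lemma pd_pd_compose:
  fixes g :: "real \<times> real \<Rightarrow> real"
  assumes W: "open W" "p \<in> W" "Ck_on 2 W \<psi>" and B: "open B" "Ck_on 2 B g" "\<psi> ` W \<subseteq> B"
  shows "pd1 (pd1 (\<lambda>q. g (\<psi> q))) p
      = hess_form g (\<psi> p) (pd1 \<psi> p) (pd1 \<psi> p) + gradient g (\<psi> p) \<bullet> pd1 (pd1 \<psi>) p"
    and "pd2 (pd1 (\<lambda>q. g (\<psi> q))) p
      = hess_form g (\<psi> p) (pd1 \<psi> p) (pd2 \<psi> p) + gradient g (\<psi> p) \<bullet> pd2 (pd1 \<psi>) p"
    and "pd2 (pd2 (\<lambda>q. g (\<psi> q))) p
      = hess_form g (\<psi> p) (pd2 \<psi> p) (pd2 \<psi> p) + gradient g (\<psi> p) \<bullet> pd2 (pd2 \<psi>) p"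
proof -
  have d: "\<psi> differentiable (at q)" "g differentiable (at (\<psi> q))" if "q \<in> W" for q
    using assms that by (auto simp: numeral_2_eq_2)
  have d': "pd1 \<psi> differentiable (at p)" "pd2 \<psi> differentiable (at p)"
    using W by (auto simp: numeral_2_eq_2)
  have \<psi>p: "\<psi> p \<in> B" using W(2) B(3) by blast
  note cong = pd_cong[OF W(1,2)] and G = pd_gradient_inner[OF B(1,2) \<psi>p d(1)[OF W(2)]]
  show "pd1 (pd1 (\<lambda>q. g (\<psi> q))) p
      = hess_form g (\<psi> p) (pd1 \<psi> p) (pd1 \<psi> p) + gradient g (\<psi> p) \<bullet> pd1 (pd1 \<psi>) p"
    using cong(1)[OF pd_compose_gradient(1)[OF d]] G(1)[OF d'(1)] by simp
  show "pd2 (pd1 (\<lambda>q. g (\<psi> q))) p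
      = hess_form g (\<psi> p) (pd1 \<psi> p) (pd2 \<psi> p) + gradient g (\<psi> p) \<bullet> pd2 (pd1 \<psi>) p"
    using cong(2)[OF pd_compose_gradient(1)[OF d]] G(2)[OF d'(1)] by simp
  show "pd2 (pd2 (\<lambda>q. g (\<psi> q))) p
      = hess_form g (\<psi> p) (pd2 \<psi> p) (pd2 \<psi> p) + gradient g (\<psi> p) \<bullet> pd2 (pd2 \<psi>) p"
    using cong(2)[OF pd_compose_gradient(2)[OF d]] G(2)[OF d'(2)] by simp
qed

text \<open>If all heights were the same linear function of the top views, the three vectors would lie in a plane; only
the deviation \<open>m\<close> of the third one contributes.\<close>

lemma det3_over_plane:
  assumes "height a = w \<bullet> top_view a" "height b = w \<bullet> top_view b"
    "height c = m + w \<bullet> top_view c"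
  shows "det3 a b c = det2 (top_view a) (top_view b) * m"
  using assms by (simp add: det3_def det2_def inner_prod_def algebra_simps)

lemma det_hess_form:
  "hess_form g q a a * hess_form g q b b - (hess_form g q a b)\<^sup>2
     = graph_curvature g q * (det2 a b)\<^sup>2"
  by (simp add: hess_form_def graph_curvature_def det2_def power2_eq_square algebra_simps)

text \<open>The classical quotient \<open>(L N - M\<^sup>2) / J\<^sup>4\<close>, with determinants in the place of the coefficients
of the second fundamental form.\<close>

definition param_curvature :: "psurf \<Rightarrow> real \<times> real \<Rightarrow> real" where
  "param_curvature X p =
     (det3 (pd1 X p) (pd2 X p) (pd1 (pd1 X) p) * det3 (pd1 X p) (pd2 X p) (pd2 (pd2 X) p)
       - (det3 (pd1 X p) (pd2 X p) (pd2 (pd1 X) p))\<^sup>2)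
     / (det2 (top_view (pd1 X p)) (top_view (pd2 X p))) ^ 4"

lemma pd_pd_linear:
  assumes L: "bounded_linear L" and W: "open W" "p \<in> W" "Ck_on 2 W X"
  shows "pd1 (\<lambda>q. L (X q)) p = L (pd1 X p)" "pd2 (\<lambda>q. L (X q)) p = L (pd2 X p)"
    and "pd1 (pd1 (\<lambda>q. L (X q))) p = L (pd1 (pd1 X) p)"
    "pd2 (pd1 (\<lambda>q. L (X q))) p = L (pd2 (pd1 X) p)"
    "pd2 (pd2 (\<lambda>q. L (X q))) p = L (pd2 (pd2 X) p)"
proof -
  have d: "X differentiable (at q)" "pd1 X differentiable (at q)" "pd2 X differentiable (at q)"
    if "q \<in> W" for q
    using W that by (auto simp: numeral_2_eq_2)
  note first = pd_linear[OF L d(1)]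
  show "pd1 (\<lambda>q. L (X q)) p = L (pd1 X p)" "pd2 (\<lambda>q. L (X q)) p = L (pd2 X p)"
    using first W(2) by blast+
  show "pd1 (pd1 (\<lambda>q. L (X q))) p = L (pd1 (pd1 X) p)"
    "pd2 (pd1 (\<lambda>q. L (X q))) p = L (pd2 (pd1 X) p)"
    "pd2 (pd2 (\<lambda>q. L (X q))) p = L (pd2 (pd2 X) p)"
    using pd_cong[OF W(1,2) first(1)] pd_cong[OF W(1,2) first(2)]
      pd_linear[OF L d(2)[OF W(2)]] pd_linear[OF L d(3)[OF W(2)]] by simp_all
qed

lemma top_regular_det2:
  assumes "X differentiable (at p)"
  shows "top_regular X p \<longleftrightarrow> det2 (top_view (pd1 X p)) (top_view (pd2 X p)) \<noteq> 0"
  unfolding top_regular_def Let_def o_def det2_def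
    pd_linear[OF bounded_linear_top_view_height(1) assms] ..

text \<open>The second derivatives of \<open>X\<close> leave the tangent plane of the graph of \<open>\<phi>\<close> by the values of the
Hessian of \<open>\<phi>\<close>.  So the three determinants are the Jacobian times the entries of the matrix of the Hessian
in the basis formed by the top views of \<open>X\<^sub>u\<close> and \<open>X\<^sub>v\<close>, and passing to the standard basis costs the squared
Jacobian.\<close>

lemma has_iso_curvature_unique:
  assumes "has_iso_curvature X p k"
  shows "k = param_curvature X p"
proof -
  obtain W B \<phi> where reg: "top_regular X p"
    and W: "open W" "p \<in> W" "Ck_on 2 W X" and B: "open B" "Ck_on 2 B \<phi>"
    and graph: "\<And>q. q \<in> W \<Longrightarrow> top_view (X q) \<in> B \<and> height (X q) = \<phi> (top_view (X q))"
    and k: "k = graph_curvature \<phi> (top_view (X p))"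
    using assms unfolding has_iso_curvature_def by blast
  note T = pd_pd_linear[OF bounded_linear_top_view_height(1) W]
  note H = pd_pd_linear[OF bounded_linear_top_view_height(2) W]
  have CT: "Ck_on 2 W (\<lambda>q. top_view (X q))"
    by (rule Ck_on_linear[OF bounded_linear_top_view_height(1) W(1,3)])
  have TB: "(\<lambda>q. top_view (X q)) ` W \<subseteq> B"
    using graph by blast
  have d: "(\<lambda>q. top_view (X q)) differentiable (at q)" "\<phi> differentiable (at (top_view (X q)))"
    if "q \<in> W" for q
    using CT TB B that by (auto simp: numeral_2_eq_2)
  have eq: "pd1 (\<lambda>q. height (X q)) q = pd1 (\<lambda>q. \<phi> (top_view (X q))) q"
    "pd2 (\<lambda>q. height (X q)) q = pd2 (\<lambda>q. \<phi> (top_view (X q))) q" if "q \<in> W" for q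
    using pd_cong[OF W(1) that, of "\<lambda>q. height (X q)" "\<lambda>q. \<phi> (top_view (X q))"] graph by blast+
  let ?z = "\<lambda>q. height (X q)" and ?z' = "\<lambda>q. \<phi> (top_view (X q))"
  note eq' = pd_cong[OF W(1,2), of "pd1 ?z" "pd1 ?z'", OF eq(1)]
    pd_cong[OF W(1,2), of "pd2 ?z" "pd2 ?z'", OF eq(2)]
  note G1 = pd_compose_gradient[OF d[OF W(2)]] and G2 = pd_pd_compose[OF W(1,2) CT B TB]
  let ?q = "top_view (X p)" and ?a = "top_view (pd1 X p)" and ?b = "top_view (pd2 X p)"
  have h: "height (pd1 X p) = gradient \<phi> ?q \<bullet> ?a" "height (pd2 X p) = gradient \<phi> ?q \<bullet> ?b"
    "height (pd1 (pd1 X) p) = hess_form \<phi> ?q ?a ?a + gradient \<phi> ?q \<bullet> (top_view (pd1 (pd1 X) p))"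
    "height (pd2 (pd1 X) p) = hess_form \<phi> ?q ?a ?b + gradient \<phi> ?q \<bullet> (top_view (pd2 (pd1 X) p))"
    "height (pd2 (pd2 X) p) = hess_form \<phi> ?q ?b ?b + gradient \<phi> ?q \<bullet> (top_view (pd2 (pd2 X) p))"
    using G1 G2 eq[OF W(2)] eq' unfolding T H by simp_all
  have "det2 ?a ?b \<noteq> 0"
    using reg top_regular_det2 W by (auto simp: numeral_2_eq_2)
  moreover have "param_curvature X p =
      (det2 ?a ?b)\<^sup>2 * (hess_form \<phi> ?q ?a ?a * hess_form \<phi> ?q ?b ?b - (hess_form \<phi> ?q ?a ?b)\<^sup>2)
        / det2 ?a ?b ^ 4"
    unfolding param_curvature_def det3_over_plane[OF h(1,2,3)] det3_over_plane[OF h(1,2,4)]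
      det3_over_plane[OF h(1,2,5)]
    by (simp add: power2_eq_square algebra_simps)
  ultimately show ?thesis
    unfolding det_hess_form k by (simp add: power2_eq_square power4_eq_xxxx)
qed

text \<open>Inverting the top view gives the graph representation \<open>height \<circ> X \<circ> g\<close>, so the definite
description in \<open>iso_curvature\<close> denotes the value computed above.\<close>

lemma iso_curvature_eq_param_curvature:
  assumes W0: "open W0" "p \<in> W0" and X: "smooth_on W0 X" and reg: "top_regular X p"
  shows "iso_curvature X p = param_curvature X p"
proof -
  let ?T = "\<lambda>q. top_view (X q)"
  have T: "smooth_on W0 ?T" and H: "smooth_on W0 (\<lambda>q. height (X q))"
    by (rule smooth_on_linear[OF W0(1) bounded_linear_top_view_height(1) X],
        rule smooth_on_linear[OF W0(1) bounded_linear_top_view_height(2) X])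
  have d: "X differentiable (at p)"
    using smooth_on_differentiable[OF X W0(2)] .
  have "det2 (pd1 ?T p) (pd2 ?T p) \<noteq> 0"
    using reg unfolding top_regular_det2[OF d] pd_linear[OF bounded_linear_top_view_height(1) d] .
  then obtain W B g where W: "open W" "p \<in> W" "W \<subseteq> W0" "open B" "?T ` W \<subseteq> B" "g ` B \<subseteq> W"
    "smooth_on B g" "\<And>q. q \<in> W \<Longrightarrow> g (?T q) = q"
    by (rule smooth_local_inverse[OF W0 T]) blast
  have "smooth_on B (\<lambda>y. height (X (g y)))"
    by (rule smooth_on_compose[OF W(4,7) _ H]) (use W in blast)
  then have "Ck_on 2 B (\<lambda>y. height (X (g y)))"
    by (rule smooth_on_imp_Ck_on)
  moreover have "Ck_on 2 W X"
    using smooth_on_imp_Ck_on[OF X] Ck_on_subset W(3) by blast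
  ultimately have "has_iso_curvature X p (graph_curvature (\<lambda>y. height (X (g y))) (top_view (X p)))"
    unfolding has_iso_curvature_def
    using reg W by (intro conjI exI[of _ W] exI[of _ B] exI[of _ "\<lambda>y. height (X (g y))"]) auto
  then have "has_iso_curvature X p (param_curvature X p)"
    using has_iso_curvature_unique by simp
  then show ?thesis
    unfolding iso_curvature_def by (rule the_equality) (rule has_iso_curvature_unique)
qed

section \<open>Ruled surfaces\<close>

text \<open>A curve \<open>A\<close> of base points and a curve \<open>B\<close> of directions are turned into functions on a strip by ignoring
the second parameter.  Thus all notions stay within functions of two variables, and both families of transversal ruled surfaces
have the form studied here.\<close>

lemma smooth_on_ruled_surface:
  assumes I: "open I" and A: "smooth_on (I \<times> UNIV) (\<lambda>q. A (fst q))"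
    and B: "smooth_on (I \<times> UNIV) (\<lambda>q. B (fst q))"
  shows "smooth_on (I \<times> UNIV) (\<lambda>q. A (fst q) + snd q *\<^sub>R B (fst q))"
proof -
  have E: "open (I \<times> UNIV :: (real \<times> real) set)"
    using I by (simp add: open_Times)
  show ?thesis
    by (intro smooth_on_intros E A B smooth_on_bounded_linear bounded_linear_snd)
qed

lemma pd_curve:
  "pd1 (\<lambda>q. A (fst q)) q = vector_derivative A (at (fst q))"
  "pd2 (\<lambda>q. A (fst q)) = (\<lambda>q. 0)"
  by (auto simp: pd1_def pd2_def)

lemma pd_ruled_surface:
  assumes I: "open I" and q: "fst q \<in> I" and A: "smooth_on (I \<times> UNIV) (\<lambda>q. A (fst q))"
    and B: "smooth_on (I \<times> UNIV) (\<lambda>q. B (fst q))"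
  shows "pd1 (\<lambda>q. A (fst q) + snd q *\<^sub>R B (fst q)) q
      = vector_derivative A (at (fst q)) + snd q *\<^sub>R vector_derivative B (at (fst q))"
    and "pd2 (\<lambda>q. A (fst q) + snd q *\<^sub>R B (fst q)) q = B (fst q)"
proof -
  have qE: "q \<in> I \<times> UNIV"
    using q by (cases q) simp
  have dA: "(\<lambda>q. A (fst q)) differentiable (at q)"
    using smooth_on_differentiable[OF A qE] .
  have dB: "(\<lambda>q. B (fst q)) differentiable (at q)"
    using smooth_on_differentiable[OF B qE] .
  have "(snd has_derivative snd) (at q)"
    by (rule bounded_linear_imp_has_derivative[OF bounded_linear_snd])
  note D = has_derivative_add[OF has_derivative_pd[OF dA]
      has_derivative_scaleR[OF this has_derivative_pd[OF dB]]]
  show "pd1 (\<lambda>q. A (fst q) + snd q *\<^sub>R B (fst q)) q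
      = vector_derivative A (at (fst q)) + snd q *\<^sub>R vector_derivative B (at (fst q))"
    using pd_of_has_derivative(1)[OF D] by (simp add: pd_curve)
  show "pd2 (\<lambda>q. A (fst q) + snd q *\<^sub>R B (fst q)) q = B (fst q)"
    using pd_of_has_derivative(2)[OF D] by (simp add: pd_curve)
qed

lemma det3_simps:
  "det3 a b 0 = 0" "det3 (a + t *\<^sub>R c) b c = det3 a b c"
  by (simp_all add: det3_def det2_def top_view_height_simps algebra_simps)

lemma det3_swap: "det3 b a c = - det3 a b c"
  by (simp add: det3_def det2_def algebra_simps)

text \<open>Since the second derivative along the rulings vanishes, only the mixed coefficient
survives, and it does not depend on the position on the ruling.\<close>

lemma iso_curvature_ruled_surface:
  assumes I: "open I" and q: "fst q \<in> I" and A: "smooth_on (I \<times> UNIV) (\<lambda>q. A (fst q))"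
    and B: "smooth_on (I \<times> UNIV) (\<lambda>q. B (fst q))"
    and reg: "top_regular (\<lambda>q. A (fst q) + snd q *\<^sub>R B (fst q)) q"
  shows "iso_curvature (\<lambda>q. A (fst q) + snd q *\<^sub>R B (fst q)) q
    = - (det3 (vector_derivative A (at (fst q))) (B (fst q)) (vector_derivative B (at (fst q))))\<^sup>2
      / (det2 (top_view (vector_derivative A (at (fst q)) + snd q *\<^sub>R vector_derivative B (at (fst q))))
          (top_view (B (fst q)))) ^ 4"
proof -
  let ?X = "\<lambda>q. A (fst q) + snd q *\<^sub>R B (fst q)"
  have E: "open (I \<times> UNIV :: (real \<times> real) set)" "q \<in> I \<times> UNIV"
    using I q by (cases q, simp add: open_Times)+
  have X: "smooth_on (I \<times> UNIV) ?X"
    by (rule smooth_on_ruled_surface[OF I A B])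
  have mixed: "pd2 (pd1 ?X) q = vector_derivative B (at (fst q))"
    using mixed_partials_commute[OF E smooth_on_imp_Ck_on[OF X]]
      pd_cong(1)[OF E, of "pd2 ?X" "\<lambda>q. B (fst q)"] pd_ruled_surface(2)[OF I _ A B]
    by (auto simp: pd_curve)
  have snd: "pd2 (pd2 ?X) q = 0"
    using pd_cong(2)[OF E, of "pd2 ?X" "\<lambda>q. B (fst q)"] pd_ruled_surface(2)[OF I _ A B]
    by (auto simp: pd_curve)
  show ?thesis
    unfolding iso_curvature_eq_param_curvature[OF E X reg] param_curvature_def mixed snd
      pd_ruled_surface[OF I q A B] det3_simps by simp
qed

section \<open>Deformations that turn the top view\<close>

definition rot90 :: "real \<times> real \<Rightarrow> real \<times> real" where
  "rot90 = (\<lambda>(x, y). (- y, x))"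

lemma bounded_linear_scaleR_rot90: "bounded_linear (\<lambda>x. s *\<^sub>R rot90 x)"
proof -
  have "bounded_linear (\<lambda>x::real \<times> real. (- snd x, fst x))"
    by (intro bounded_linear_Pair bounded_linear_minus bounded_linear_fst bounded_linear_snd)
  moreover have "(\<lambda>x::real \<times> real. (- snd x, fst x)) = rot90"
    by (auto simp: rot90_def)
  ultimately show ?thesis
    using bounded_linear_compose[OF bounded_linear_scaleR_right] by metis
qed

text \<open>With \<open>s = 1\<close> or \<open>s = -1\<close>, this relates the pairs \<open>(F, V)\<close> and \<open>(C, C')\<close>, which are turned in
opposite directions.  As a linear relation it passes to derivatives.\<close>

definition rotated_top :: "real \<Rightarrow> point \<Rightarrow> point \<Rightarrow> bool" where
  "rotated_top s a b \<longleftrightarrow> top_view b = s *\<^sub>R rot90 (top_view a)"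

lemma rotated_top_linear:
  assumes "rotated_top s a a'" "rotated_top s b b'"
  shows "rotated_top s (a + t *\<^sub>R b) (a' + t *\<^sub>R b')"
  using assms by (simp add: rotated_top_def rot90_def top_view_height_simps algebra_simps)

lemma rotated_top_pd:
  assumes "open E" "q \<in> E" "X differentiable (at q)" "Y differentiable (at q)"
    and rot: "\<And>q. q \<in> E \<Longrightarrow> rotated_top s (X q) (Y q)"
  shows "rotated_top s (pd1 X q) (pd1 Y q)" "rotated_top s (pd2 X q) (pd2 Y q)"
proof -
  note tv = bounded_linear_top_view_height(1)
  let ?L = "\<lambda>x. s *\<^sub>R rot90 (top_view x)"
  have L: "bounded_linear ?L"
    using bounded_linear_compose[OF bounded_linear_scaleR_rot90 tv] .
  have "top_view (Y q) = ?L (X q)" if "q \<in> E" for q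
    using rot[OF that] by (simp add: rotated_top_def)
  note cong = pd_cong[OF assms(1,2), of "\<lambda>q. top_view (Y q)" "\<lambda>q. ?L (X q)", OF this]
  show "rotated_top s (pd1 X q) (pd1 Y q)" "rotated_top s (pd2 X q) (pd2 Y q)"
    using cong pd_linear[OF tv assms(4)] pd_linear[OF L assms(3)]
    by (simp_all add: rotated_top_def)
qed

text \<open>Adding \<open>e\<close> times a vector turned by a right angle is a similarity of the plane with squared ratio
\<open>1 + e\<^sup>2\<close>, and the quarter turn itself preserves areas.\<close>

lemma rotated_deformation_scaling:
  assumes "s\<^sup>2 = 1" "rotated_top s a a'" "rotated_top s b b'"
  shows "det2 (top_view (a + e *\<^sub>R a')) (top_view (b + e *\<^sub>R b'))
      = (1 + e\<^sup>2) * det2 (top_view a) (top_view b)"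
    and "top_view (a + e *\<^sub>R a') \<bullet> top_view (b + e *\<^sub>R b')
      = (1 + e\<^sup>2) * (top_view a \<bullet> top_view b)"
    and "det2 (top_view a') (top_view b') = det2 (top_view a) (top_view b)"
proof -
  have s: "s * s = 1" using assms(1) by (simp add: power2_eq_square)
  have s': "s * (s * x) = x" for x using s by (simp add: mult.assoc[symmetric])
  have c: "fst a' = - s * fst (snd a)" "fst (snd a') = s * fst a"
    "fst b' = - s * fst (snd b)" "fst (snd b') = s * fst b"
    using assms(2,3) by (simp_all add: rotated_top_def rot90_def top_view_height_simps)
  show "det2 (top_view (a + e *\<^sub>R a')) (top_view (b + e *\<^sub>R b'))
      = (1 + e\<^sup>2) * det2 (top_view a) (top_view b)"
    by (simp add: det2_def top_view_height_simps c power2_eq_square algebra_simps s')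
  show "top_view (a + e *\<^sub>R a') \<bullet> top_view (b + e *\<^sub>R b')
      = (1 + e\<^sup>2) * (top_view a \<bullet> top_view b)"
    by (simp add: top_view_height_simps c power2_eq_square algebra_simps s')
  show "det2 (top_view a') (top_view b') = det2 (top_view a) (top_view b)"
    by (simp add: det2_def top_view_height_simps c power2_eq_square algebra_simps s')
qed

text \<open>In the expansion along heights, all minors of the top view scale by \<open>1 + e\<^sup>2\<close>, and they are the same for
the two triples of vectors; the heights are added.\<close>

lemma det3_rotated_deformation:
  assumes "s\<^sup>2 = 1" "rotated_top s a a'" "rotated_top s b b'" "rotated_top s c c'"
  shows "det3 (a + e *\<^sub>R a') (b + e *\<^sub>R b') (c + e *\<^sub>R c') = (1 + e\<^sup>2) * (det3 a b c + e * det3 a' b' c')"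
proof -
  note d = rotated_deformation_scaling[OF assms(1)]
  have h: "height (x + e *\<^sub>R y) = height x + e * height y" for x y
    by (simp add: top_view_height_simps)
  show ?thesis
    unfolding det3_def d(1)[OF assms(2,3)] d(1)[OF assms(2,4)] d(1)[OF assms(3,4)]
      d(3)[OF assms(2,3)] d(3)[OF assms(2,4)] d(3)[OF assms(3,4)] h
    by (simp add: algebra_simps)
qed

lemma metric_preserved_if_rotated:
  assumes s: "s\<^sup>2 = 1" and E: "open E" "q \<in> E" and X: "smooth_on E X" and Y: "smooth_on E Y"
    and rot: "\<And>q. q \<in> E \<Longrightarrow> rotated_top s (X q) (Y q)"
  shows "metric_preserved X Y q"
proof -
  have d: "X differentiable (at q)" "Y differentiable (at q)"
    using smooth_on_differentiable X Y E(2) by blast+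
  have r: "rotated_top s (pd1 X q) (pd1 Y q)" "rotated_top s (pd2 X q) (pd2 Y q)"
    by (rule rotated_top_pd[OF E d], erule rot)+
  have D: "((\<lambda>q. X q + e *\<^sub>R Y q) has_derivative (\<lambda>h. (fst h *\<^sub>R pd1 X q + snd h *\<^sub>R pd2 X q)
      + e *\<^sub>R (fst h *\<^sub>R pd1 Y q + snd h *\<^sub>R pd2 Y q))) (at q)" for e
    by (intro has_derivative_add has_derivative_scaleR_right has_derivative_pd d)
  have pd: "pd1 (top_view \<circ> deform X Y e) q = top_view (pd1 X q + e *\<^sub>R pd1 Y q)"
    "pd2 (top_view \<circ> deform X Y e) q = top_view (pd2 X q + e *\<^sub>R pd2 Y q)" for e
    using pd_of_has_derivative[OF bounded_linear.has_derivative[OF bounded_linear_top_view_height(1) D[of e]]]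
    by (simp_all add: o_def deform_def)
  have "((\<lambda>e::real. (1 + e\<^sup>2) * k) has_real_derivative 0) (at 0)" for k :: real
    by (auto intro!: derivative_eq_intros)
  then show ?thesis
    unfolding metric_preserved_def pd rotated_deformation_scaling(2)[OF s r(1) r(1)]
      rotated_deformation_scaling(2)[OF s r(1) r(2)] rotated_deformation_scaling(2)[OF s r(2) r(2)]
    by blast
qed

text \<open>The factor \<open>1 + e\<^sup>2\<close> is stationary at \<open>0\<close>, so only the linear term in the numerator contributes.\<close>

lemma curvature_derivative:
  fixes j x y :: real
  assumes "j \<noteq> 0"
  shows "((\<lambda>e. - ((1 + e\<^sup>2) * (x + e * y))\<^sup>2 / ((1 + e\<^sup>2) * j) ^ 4)
    has_real_derivative - 2 * (x * y) / j ^ 4) (at 0)"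
  using assms by (auto intro!: derivative_eq_intros simp: field_simps power2_eq_square)
      
lemma vector_derivative_deformed_curve:
  assumes I: "open I" "u \<in> I" and A: "smooth_on (I \<times> UNIV) (\<lambda>q. A (fst q))"
    and a: "smooth_on (I \<times> UNIV) (\<lambda>q. a (fst q))"
  shows "vector_derivative (\<lambda>u. A u + e *\<^sub>R a u) (at u)
    = vector_derivative A (at u) + e *\<^sub>R vector_derivative a (at u)"
proof -
  have uE: "(u, 0::real) \<in> I \<times> UNIV" using I by simp
  have "(\<lambda>q. e *\<^sub>R a (fst q)) differentiable (at (u, 0::real))"
    using bounded_linear.has_derivative[OF bounded_linear_scaleR_right[of e]
        has_derivative_pd[OF smooth_on_differentiable[OF a uE]]]
    unfolding differentiable_def by blast
  then have "pd1 (\<lambda>q. A (fst q) + e *\<^sub>R a (fst q)) (u, 0)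
      = vector_derivative A (at u) + e *\<^sub>R vector_derivative a (at u)"
    using pd_add(1)[OF smooth_on_differentiable[OF A uE]]
      pd_linear(1)[OF bounded_linear_scaleR_right[of e] smooth_on_differentiable[OF a uE]]
    by (simp add: pd_curve(1))
  then show ?thesis
    using pd_curve(1)[of "\<lambda>u. A u + e *\<^sub>R a u" "(u, 0)"] by simp
qed

text \<open>The deformed surface is again ruled, with curves \<open>A + e a\<close> and \<open>B + e b\<close>, and remains
regular for every \<open>e\<close>.  Hence its curvature is known in closed form, and the derivative at \<open>e = 0\<close> is
proportional to \<open>\<Delta> A B * \<Delta> a b\<close>.\<close>

lemma ruled_surface_deformation:
  assumes s: "s\<^sup>2 = 1" and I: "open I" and q: "fst q \<in> I"
    and A: "smooth_on (I \<times> UNIV) (\<lambda>q. A (fst q))" and B: "smooth_on (I \<times> UNIV) (\<lambda>q. B (fst q))"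
    and a: "smooth_on (I \<times> UNIV) (\<lambda>q. a (fst q))" and b: "smooth_on (I \<times> UNIV) (\<lambda>q. b (fst q))"
    and rot: "\<And>u. u \<in> I \<Longrightarrow> rotated_top s (A u) (a u)" "\<And>u. u \<in> I \<Longrightarrow> rotated_top s (B u) (b u)"
  defines "X \<equiv> \<lambda>q. A (fst q) + snd q *\<^sub>R B (fst q)" and "Y \<equiv> \<lambda>q. a (fst q) + snd q *\<^sub>R b (fst q)"
    and "\<Delta> \<equiv> \<lambda>A B. det3 (vector_derivative A (at (fst q))) (B (fst q)) (vector_derivative B (at (fst q)))"
  shows "metric_preserved X Y q"
    and "top_regular X q \<Longrightarrow> curvature_preserved X Y q \<longleftrightarrow> \<Delta> A B * \<Delta> a b = 0"
proof -
  have E: "open (I \<times> UNIV :: (real \<times> real) set)" "q \<in> I \<times> UNIV"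
    using I q by (cases q, simp add: open_Times)+
  have X: "smooth_on (I \<times> UNIV) X" and Y: "smooth_on (I \<times> UNIV) Y"
    unfolding X_def Y_def by (intro smooth_on_ruled_surface[OF I] A B a b)+
  show "metric_preserved X Y q"
    by (rule metric_preserved_if_rotated[OF s E X Y])
      (use rot in \<open>auto simp: X_def Y_def intro!: rotated_top_linear\<close>)
  assume reg: "top_regular X q"
  let ?d = "\<lambda>A. vector_derivative A (at (fst q))"
  have "rotated_top s (?d A) (?d a)" "rotated_top s (?d B) (?d b)"
    using rotated_top_pd(1)[OF E smooth_on_differentiable[OF A E(2)] smooth_on_differentiable[OF a E(2)]]
      rotated_top_pd(1)[OF E smooth_on_differentiable[OF B E(2)] smooth_on_differentiable[OF b E(2)]] rot
    by (auto simp: pd_curve)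
  note rot' = this rot(2)[OF q]
  define j where "j = det2 (top_view (?d A + snd q *\<^sub>R ?d B)) (top_view (B (fst q)))"
  have "j \<noteq> 0"
    using reg unfolding top_regular_det2[OF smooth_on_differentiable[OF X E(2)]] j_def
    unfolding X_def pd_ruled_surface[OF I q A B] .
  have "iso_curvature (deform X Y e) q = - ((1 + e\<^sup>2) * (\<Delta> A B + e * \<Delta> a b))\<^sup>2 / ((1 + e\<^sup>2) * j) ^ 4" for e
  proof -
    let ?A = "\<lambda>u. A u + e *\<^sub>R a u" and ?B = "\<lambda>u. B u + e *\<^sub>R b u"
    have def: "deform X Y e = (\<lambda>q. ?A (fst q) + snd q *\<^sub>R ?B (fst q))"
      by (auto simp: deform_def X_def Y_def algebra_simps)
    have AB: "smooth_on (I \<times> UNIV) (\<lambda>q. ?A (fst q))" "smooth_on (I \<times> UNIV) (\<lambda>q. ?B (fst q))"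
      by (intro smooth_on_intros E A B a b)+
    note vd = vector_derivative_deformed_curve[OF I q A a] vector_derivative_deformed_curve[OF I q B b]
    have j: "det2 (top_view (?d ?A + snd q *\<^sub>R ?d ?B)) (top_view (?B (fst q))) = (1 + e\<^sup>2) * j"
      using rotated_deformation_scaling(1)[OF s rotated_top_linear[OF rot'(1,2), of "snd q"] rot'(3), of e]
      unfolding vd j_def by (simp add: algebra_simps)
    have "1 + e\<^sup>2 \<noteq> 0" by (smt (verit) zero_le_power2)
    then have reg': "top_regular (deform X Y e) q"
      using \<open>j \<noteq> 0\<close> smooth_on_differentiable[OF smooth_on_ruled_surface[OF I AB] E(2)]
      unfolding def by (simp add: top_regular_det2 pd_ruled_surface[OF I q AB] j)
    show ?thesis
      unfolding def iso_curvature_ruled_surface[OF I q AB reg'[unfolded def]] j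
      unfolding vd det3_rotated_deformation[OF s rot'(1,3,2)] \<Delta>_def ..
  qed
  then have D: "((\<lambda>e. iso_curvature (deform X Y e) q) has_real_derivative
      - 2 * (\<Delta> A B * \<Delta> a b) / j ^ 4) (at 0)" (is "(_ has_real_derivative ?k) _")
    using curvature_derivative[OF \<open>j \<noteq> 0\<close>] by simp
  have "curvature_preserved X Y q \<longleftrightarrow> ?k = 0"
  proof
    show "?k = 0" if "curvature_preserved X Y q"
      using DERIV_unique[OF D] that unfolding curvature_preserved_def by blast
    show "curvature_preserved X Y q" if "?k = 0"
      using D unfolding that curvature_preserved_def .
  qed
  then show "curvature_preserved X Y q \<longleftrightarrow> \<Delta> A B * \<Delta> a b = 0"
    using \<open>j \<noteq> 0\<close> by simp
qed

section \<open>Conjugate nets and transversal ruled surfaces\<close>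

definition net_det :: "psurf \<Rightarrow> real \<times> real \<Rightarrow> real" where
  "net_det G p = det3 (pd1 G p) (pd2 G p) (pd2 (pd1 G) p)"

lemma in_span_pair_iff_det3:
  assumes "det2 (top_view a) (top_view b) \<noteq> 0"
  shows "c \<in> span {a, b} \<longleftrightarrow> det3 a b c = 0"
proof
  assume "c \<in> span {a, b}"
  then obtain s t where "c - s *\<^sub>R a = t *\<^sub>R b"
    by (auto simp: span_breakdown_eq span_singleton)
  then have c: "c = s *\<^sub>R a + t *\<^sub>R b"
    by (simp add: algebra_simps)
  show "det3 a b c = 0"
    unfolding c by (simp add: det3_def det2_def top_view_height_simps algebra_simps)
next
  assume 0: "det3 a b c = 0"
  obtain a1 a2 a3 b1 b2 b3 c1 c2 c3
    where abc: "a = (a1, a2, a3)" "b = (b1, b2, b3)" "c = (c1, c2, c3)"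
    by (metis surj_pair)
  define j where "j = a1 * b2 - a2 * b1"
  have j: "j \<noteq> 0"
    using assms by (simp add: abc det2_def top_view_height_simps j_def)
  have "c3 * j = (c1 * b2 - c2 * b1) * a3 + (a1 * c2 - a2 * c1) * b3"
    using 0 by (simp add: abc det3_def det2_def top_view_height_simps j_def algebra_simps)
  moreover have "c1 * j = (c1 * b2 - c2 * b1) * a1 + (a1 * c2 - a2 * c1) * b1"
    "c2 * j = (c1 * b2 - c2 * b1) * a2 + (a1 * c2 - a2 * c1) * b2"
    by (simp_all add: j_def algebra_simps)
  ultimately have "c = ((c1 * b2 - c2 * b1) / j) *\<^sub>R a + ((a1 * c2 - a2 * c1) / j) *\<^sub>R b"
    using j by (simp add: abc add_divide_distrib[symmetric] nonzero_eq_divide_eq)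
  then show "c \<in> span {a, b}"
    by (metis insertI1 insertI2 span_add span_base span_scale)
qed

lemma Q_net_iff_net_det:
  assumes "\<And>p. p \<in> D \<Longrightarrow> det2 (top_view (pd1 G p)) (top_view (pd2 G p)) \<noteq> 0"
  shows "Q_net D G \<longleftrightarrow> (\<forall>p\<in>D. net_det G p = 0)"
  using in_span_pair_iff_det3 assms by (simp add: Q_net_def net_det_def)

lemma open_slices:
  assumes "open D"
  shows "open {u. (u, v0) \<in> D}" "open {v. (u0, v) \<in> D}"
  using open_vimage[OF assms, of "\<lambda>u. (u, v0)"] open_vimage[OF assms, of "\<lambda>v. (u0, v)"]
  by (auto simp: vimage_def continuous_intros)

lemma smooth_on_slices:
  assumes D: "open D" and G: "smooth_on D G"
  shows "smooth_on ({u. (u, v0) \<in> D} \<times> UNIV) (\<lambda>q. G (fst q, v0))"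
    and "smooth_on ({v. (u0, v) \<in> D} \<times> UNIV) (\<lambda>q. G (u0, fst q))"
proof -
  have E: "open ({u. (u, v0) \<in> D} \<times> (UNIV :: real set))" "open ({v. (u0, v) \<in> D} \<times> (UNIV :: real set))"
    using open_slices[OF D] by (simp_all add: open_Times)
  have "smooth_on ({u. (u, v0) \<in> D} \<times> UNIV) (\<lambda>q::real \<times> real. (fst q, v0))"
    "smooth_on ({v. (u0, v) \<in> D} \<times> UNIV) (\<lambda>q::real \<times> real. (u0, fst q))"
    by (intro smooth_on_Pair smooth_on_const smooth_on_bounded_linear E bounded_linear_fst)+
  note embed = this
  show "smooth_on ({u. (u, v0) \<in> D} \<times> UNIV) (\<lambda>q. G (fst q, v0))"
    by (rule smooth_on_compose[OF E(1) embed(1) _ G]) auto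
  show "smooth_on ({v. (u0, v) \<in> D} \<times> UNIV) (\<lambda>q. G (u0, fst q))"
    by (rule smooth_on_compose[OF E(2) embed(2) _ G]) auto
qed

lemma pd_slices:
  "pd1 G (u, v) = vector_derivative (\<lambda>u. G (u, v)) (at u)"
  "pd2 G (u, v) = vector_derivative (\<lambda>v. G (u, v)) (at v)"
  by (simp_all add: pd1_def pd2_def)

lemma top_regular_ruled_surface_base:
  assumes I: "open I" and q: "fst q \<in> I" "snd q = 0" and A: "smooth_on (I \<times> UNIV) (\<lambda>q. A (fst q))"
    and B: "smooth_on (I \<times> UNIV) (\<lambda>q. B (fst q))"
    and det: "det2 (top_view (vector_derivative A (at (fst q)))) (top_view (B (fst q))) \<noteq> 0"
  shows "top_regular (\<lambda>q. A (fst q) + snd q *\<^sub>R B (fst q)) q"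
proof -
  have "q \<in> I \<times> UNIV" using q by (cases q) simp
  with smooth_on_ruled_surface[OF I A B] smooth_on_differentiable
  have "(\<lambda>q. A (fst q) + snd q *\<^sub>R B (fst q)) differentiable (at q)" by blast
  then show ?thesis
    using det by (simp add: top_regular_det2 pd_ruled_surface[OF I q(1) A B] q(2))
qed

text \<open>Both families of ruled surfaces lead to the same two determinants up to sign, because mixed derivatives
commute.  On the base curve \<open>t = 0\<close> the ruled surfaces are regular, so there the condition on the
curvature is effective at every point of the net.\<close>

lemma induces_ruled_isometries_iff:
  assumes s: "s\<^sup>2 = 1" and D: "open D" and G: "smooth_on D G" and W: "smooth_on D W"
    and rot: "\<And>p. p \<in> D \<Longrightarrow> rotated_top s (G p) (W p)"
    and reg: "\<And>p. p \<in> D \<Longrightarrow> det2 (top_view (pd1 G p)) (top_view (pd2 G p)) \<noteq> 0"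
  shows "induces_ruled_isometries D G W \<longleftrightarrow> (\<forall>p\<in>D. net_det G p * net_det W p = 0)"
proof -
  have rot': "rotated_top s (pd1 G p) (pd1 W p)" "rotated_top s (pd2 G p) (pd2 W p)" if "p \<in> D" for p
    by (rule rotated_top_pd[OF D that smooth_on_differentiable[OF G that] smooth_on_differentiable[OF W that]],
        erule rot)+
  have mixed: "pd1 (pd2 G) p = pd2 (pd1 G) p" "pd1 (pd2 W) p = pd2 (pd1 W) p" if "p \<in> D" for p
    using mixed_partials_commute[OF D that smooth_on_imp_Ck_on[OF G]]
      mixed_partials_commute[OF D that smooth_on_imp_Ck_on[OF W]] by simp_all
  note sm = smooth_on_pd[OF G] smooth_on_pd[OF W]
  have u: "metric_preserved (ruled_u G v0) (ruled_u W v0) (u, t)"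
    "top_regular (ruled_u G v0) (u, t) \<Longrightarrow>
      curvature_preserved (ruled_u G v0) (ruled_u W v0) (u, t)
      \<longleftrightarrow> net_det G (u, v0) * net_det W (u, v0) = 0"
    "top_regular (ruled_u G v0) (u, 0)"
    if p: "(u, v0) \<in> D" for u v0 t
  proof -
    let ?I = "{u. (u, v0) \<in> D}"
    have uI: "fst (u, t) \<in> ?I" "fst (u, 0::real) \<in> ?I" using p by simp_all
    have r: "ruled_u X v0 = (\<lambda>q. X (fst q, v0) + snd q *\<^sub>R pd2 X (fst q, v0))" for X
      by (auto simp: ruled_u_def)
    note I = open_slices(1)[OF D, of v0]
    note S = smooth_on_slices(1)[OF D, of _ v0]
    note def = ruled_surface_deformation[OF s I uI(1) S[OF G] S[OF sm(2)] S[OF W] S[OF sm(4)], folded r]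
    show "metric_preserved (ruled_u G v0) (ruled_u W v0) (u, t)"
      by (rule def(1)) (use rot rot' in auto)
    show "curvature_preserved (ruled_u G v0) (ruled_u W v0) (u, t)
      \<longleftrightarrow> net_det G (u, v0) * net_det W (u, v0) = 0" if "top_regular (ruled_u G v0) (u, t)"
      using def(2)[OF _ _ that] rot rot' 
      by (simp add: net_det_def mixed[OF p, symmetric] pd_slices(1)[symmetric])
    show "top_regular (ruled_u G v0) (u, 0)"
      unfolding r
      by (rule top_regular_ruled_surface_base[OF I uI(2) _ S[OF G] S[OF sm(2)]])
        (use reg[OF p] in \<open>simp_all add: pd_slices(1)[symmetric]\<close>)
  qed
  have v: "metric_preserved (ruled_v G u0) (ruled_v W u0) (v, t)"
    "top_regular (ruled_v G u0) (v, t) \<Longrightarrow>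
      curvature_preserved (ruled_v G u0) (ruled_v W u0) (v, t)
      \<longleftrightarrow> net_det G (u0, v) * net_det W (u0, v) = 0"
    if p: "(u0, v) \<in> D" for u0 v t
  proof -
    let ?I = "{v. (u0, v) \<in> D}"
    have vI: "fst (v, t) \<in> ?I" using p by simp
    have r: "ruled_v X u0 = (\<lambda>q. X (u0, fst q) + snd q *\<^sub>R pd1 X (u0, fst q))" for X
      by (auto simp: ruled_v_def)
    note I = open_slices(2)[OF D, of u0]
    note S = smooth_on_slices(2)[OF D, of _ u0]
    note def = ruled_surface_deformation[OF s I vI S[OF G] S[OF sm(1)] S[OF W] S[OF sm(3)], folded r]
    show "metric_preserved (ruled_v G u0) (ruled_v W u0) (v, t)"
      by (rule def(1)) (use rot rot' in auto)
    show "curvature_preserved (ruled_v G u0) (ruled_v W u0) (v, t)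
      \<longleftrightarrow> net_det G (u0, v) * net_det W (u0, v) = 0" if "top_regular (ruled_v G u0) (v, t)"
      using def(2)[OF _ _ that] rot rot' 
      by (simp add: net_det_def pd_slices(2)[symmetric] det3_swap[of "pd2 _ _"])
  qed
  show ?thesis
  proof
    assume ind: "induces_ruled_isometries D G W"
    show "\<forall>p\<in>D. net_det G p * net_det W p = 0"
    proof
      fix p assume "p \<in> D"
      then obtain u v0 where p: "p = (u, v0)" "(u, v0) \<in> D" by (cases p) auto
      then have "curvature_preserved (ruled_u G v0) (ruled_u W v0) (u, 0)"
        using ind u(3) unfolding induces_ruled_isometries_def infinitesimal_isometry_def by blast
      then show "net_det G p * net_det W p = 0"
        using u(2)[OF p(2) u(3)[OF p(2)]] p(1) by blast
    qed
  next
    assume "\<forall>p\<in>D. net_det G p * net_det W p = 0"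
    then show "induces_ruled_isometries D G W"
      unfolding induces_ruled_isometries_def infinitesimal_isometry_def using u v by auto
  qed
qed

text \<open>For the second part: the set where \<open>W\<close> fails to be conjugate is open, and there the vanishing product
makes \<open>G\<close> conjugate, contrary to skewness unless the set is empty.\<close>

lemma Q_net_and_induced_isometries:
  assumes s: "s\<^sup>2 = 1" and D: "open D" and G: "smooth_on D G" and W: "smooth_on D W"
    and rot: "\<And>p. p \<in> D \<Longrightarrow> rotated_top s (G p) (W p)"
    and reg: "\<And>p. p \<in> D \<Longrightarrow> top_regular G p"
  shows "Q_net D W \<Longrightarrow> induces_ruled_isometries D G W"
    and "skew_transversals D G \<Longrightarrow> induces_ruled_isometries D G W \<Longrightarrow> Q_net D W"
proof -
  have dG: "det2 (top_view (pd1 G p)) (top_view (pd2 G p)) \<noteq> 0" if "p \<in> D" for p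
    using reg[OF that] top_regular_det2 smooth_on_differentiable[OF G that] by blast
  have rot': "rotated_top s (pd1 G p) (pd1 W p)" "rotated_top s (pd2 G p) (pd2 W p)" if "p \<in> D" for p
    by (rule rotated_top_pd[OF D that smooth_on_differentiable[OF G that] smooth_on_differentiable[OF W that]],
        erule rot)+
  have dW: "det2 (top_view (pd1 W p)) (top_view (pd2 W p)) \<noteq> 0" if "p \<in> D" for p
    using dG[OF that] rotated_deformation_scaling(3)[OF s rot'[OF that]] by simp
  note iff = induces_ruled_isometries_iff[OF s D G W rot dG]
  show "induces_ruled_isometries D G W" if "Q_net D W"
    using that Q_net_iff_net_det[OF dW] iff by simp
  assume skew: "skew_transversals D G" and ind: "induces_ruled_isometries D G W"
  show "Q_net D W"
  proof (rule ccontr)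
    define E where "E = {p \<in> D. net_det W p \<noteq> 0}"
    assume "\<not> Q_net D W"
    then have "E \<noteq> {}"
      using Q_net_iff_net_det[OF dW] by (auto simp: E_def)
    have "continuous_on D (pd1 W)" "continuous_on D (pd2 W)" "continuous_on D (pd2 (pd1 W))"
      using smooth_on_pd[OF W] smooth_on_pd(2)[OF smooth_on_pd(1)[OF W]] smooth_on_imp_Ck_on[of D _ 0]
      by (metis Ck_on.simps(1))+
    then have "continuous_on D (net_det W)"
      unfolding net_det_def[abs_def] det3_def det2_def top_view_height_simps fst_conv snd_conv
      by (intro continuous_intros)
    then have "open E"
      unfolding E_def
      using continuous_open_preimage[OF _ D, of "net_det W" "- {0}"]
      by (simp add: vimage_def Int_def open_Compl)
    moreover have "Q_net E G"
      using Q_net_iff_net_det[of E G] dG ind iff by (auto simp: E_def)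
    ultimately show False
      using skew \<open>E \<noteq> {}\<close> unfolding skew_transversals_def E_def by blast
  qed
qed

section \<open>The velocity, rotation and translation diagrams\<close>

lemma det2_rot90: "det2 (rot90 x) (rot90 y) = det2 x y" "det2 (rot90 x) y = - (x \<bullet> y)"
  by (simp_all add: det2_def rot90_def inner_prod_def algebra_simps split: prod.split)

lemma rot90_inner: "rot90 x \<bullet> rot90 y = x \<bullet> y"
  by (simp add: rot90_def inner_prod_def algebra_simps split: prod.split)

lemma pd_top_view_height:
  assumes "X differentiable (at p)"
  shows "top_view (pd1 X p) = pd1 (\<lambda>q. top_view (X q)) p"
    and "top_view (pd2 X p) = pd2 (\<lambda>q. top_view (X q)) p"
    and "height (pd1 X p) = pd1 (\<lambda>q. height (X q)) p"
    and "height (pd2 X p) = pd2 (\<lambda>q. height (X q)) p"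
  using pd_linear[OF bounded_linear_top_view_height(1) assms]
    pd_linear[OF bounded_linear_top_view_height(2) assms] by simp_all

text \<open>The tangent planes of \<open>X\<close> are spanned by vectors of the form \<open>(rot90 x, w \<bullet> x)\<close>, and the mixed
derivative leaves such a plane by \<open>m\<close>.  It is applied with \<open>\<xi> = \<psi>\<close> to the net \<open>V\<close> and with \<open>\<xi> = \<nu>\<close> to \<open>C'\<close>.\<close>

lemma Q_net_over_rotated_top:
  assumes D: "open D" and X: "smooth_on D X" and \<xi>: "smooth_on D \<xi>"
    and top: "\<And>q. top_view (X q) = rot90 (\<xi> q)"
    and det: "\<And>q. q \<in> D \<Longrightarrow> det2 (pd1 \<xi> q) (pd2 \<xi> q) \<noteq> 0"
    and z1: "\<And>q. q \<in> D \<Longrightarrow> pd1 (\<lambda>q. height (X q)) q = w q \<bullet> pd1 \<xi> q"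
    and z2: "\<And>q. q \<in> D \<Longrightarrow> pd2 (\<lambda>q. height (X q)) q = w q \<bullet> pd2 \<xi> q"
    and z12: "\<And>q. q \<in> D \<Longrightarrow>
      pd2 (pd1 (\<lambda>q. height (X q))) q = m q + w q \<bullet> pd2 (pd1 \<xi>) q"
  shows "Q_net D X \<longleftrightarrow> (\<forall>q\<in>D. m q = 0)"
proof -
  have det3: "det3 (pd1 X q) (pd2 X q) (pd2 (pd1 X) q) = det2 (pd1 \<xi> q) (pd2 \<xi> q) * m q"
    "det2 (top_view (pd1 X q)) (top_view (pd2 X q)) = det2 (pd1 \<xi> q) (pd2 \<xi> q)"
    if q: "q \<in> D" for q
  proof -
    have R: "bounded_linear rot90"
      using bounded_linear_scaleR_rot90[of 1] by simp
    note L = pd_pd_linear[OF R D q smooth_on_imp_Ck_on[OF \<xi>]]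
    note T = pd_pd_linear[OF bounded_linear_top_view_height(1) D q smooth_on_imp_Ck_on[OF X]]
    note H = pd_pd_linear[OF bounded_linear_top_view_height(2) D q smooth_on_imp_Ck_on[OF X]]
    have t: "top_view (pd1 X q) = rot90 (pd1 \<xi> q)" "top_view (pd2 X q) = rot90 (pd2 \<xi> q)"
      "top_view (pd2 (pd1 X) q) = rot90 (pd2 (pd1 \<xi>) q)"
      using L T by (simp_all add: top)
    have h: "height (pd1 X q) = rot90 (w q) \<bullet> top_view (pd1 X q)"
      "height (pd2 X q) = rot90 (w q) \<bullet> top_view (pd2 X q)"
      "height (pd2 (pd1 X) q) = m q + rot90 (w q) \<bullet> top_view (pd2 (pd1 X) q)"
      using H z1[OF q] z2[OF q] z12[OF q] by (simp_all add: t rot90_inner)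
    show "det3 (pd1 X q) (pd2 X q) (pd2 (pd1 X) q) = det2 (pd1 \<xi> q) (pd2 \<xi> q) * m q"
      unfolding det3_over_plane[OF h] unfolding t det2_rot90(1) ..
    show "det2 (top_view (pd1 X q)) (top_view (pd2 X q)) = det2 (pd1 \<xi> q) (pd2 \<xi> q)"
      unfolding t det2_rot90(1) ..
  qed
  show ?thesis
    using Q_net_iff_net_det[of D X] det det3 by (simp add: net_det_def)
qed

text \<open>The plane of the two vectors projects injectively to the top view.\<close>

lemma collinear_in_plane_iff:
  assumes a: "height a = w \<bullet> top_view a" and b: "height b = w \<bullet> top_view b"
    and "top_view b \<noteq> 0"
  shows "collinear {0, a, b} \<longleftrightarrow> det2 (top_view a) (top_view b) = 0"
proof
  assume "collinear {0, a, b}"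
  then show "det2 (top_view a) (top_view b) = 0"
    by (auto simp: collinear_lemma det2_def top_view_height_simps)
next
  assume 0: "det2 (top_view a) (top_view b) = 0"
  obtain a1 a2 a3 b1 b2 b3 where ab: "a = (a1, a2, a3)" "b = (b1, b2, b3)"
    by (metis surj_pair)
  obtain w1 w2 where w: "w = (w1, w2)" by fastforce
  define k where "k = (a1 * b1 + a2 * b2) / (b1 * b1 + b2 * b2)"
  have "b1 * b1 + b2 * b2 \<noteq> 0"
    using \<open>top_view b \<noteq> 0\<close> by (simp add: ab top_view_height_simps zero_prod_def)
  moreover have "a1 * b2 = a2 * b1"
    using 0 by (simp add: ab det2_def top_view_height_simps)
  ultimately have k: "a1 = k * b1" "a2 = k * b2"
    unfolding k_def by (simp_all add: nonzero_eq_divide_eq) (simp_all add: algebra_simps)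
  then have "a = k *\<^sub>R b"
    using a b by (simp add: ab w top_view_height_simps algebra_simps)
  then show "collinear {0, a, b}"
    using collinear_lemma[of b a] by (auto simp: insert_commute)
qed

theorem proposition55:
  fixes U D :: "(real \<times> real) set"
    and f n c :: "real \<times> real \<Rightarrow> real"
    and \<psi> :: "real \<times> real \<Rightarrow> real \<times> real"
    and F V C C' :: "real \<times> real \<Rightarrow> real \<times> real \<times> real"
  assumes "open U" and "smooth_on U f" and "smooth_on U n" and "smooth_on U c"
    and "flexion_equation U f n" and "\<not> trivial_velocity U n"
    and "rotation_height U f n c"
    and "open D" and "smooth_on D \<psi>" and "\<psi> ` D \<subseteq> U"
    and "F = graph_surface f \<circ> \<psi>"
    and "V = velocity_diagram n \<circ> \<psi>"
    and "C = rotation_diagram n c \<circ> \<psi>"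
    and "C' = translation_diagram n \<circ> \<psi>"
    and "\<forall>p\<in>D. top_regular F p" and "\<forall>p\<in>D. top_regular C p"
  shows
    "(Q_net D V \<longleftrightarrow> Q_net D C') \<and>
     (Q_net D V \<longleftrightarrow> reciprocal_parallel D (motion_L \<circ> C) F) \<and>
     (Q_net D V \<longrightarrow> induces_ruled_isometries D F V) \<and>
     (Q_net D V \<longrightarrow> induces_ruled_isometries D C C') \<and>
     (skew_transversals D F \<longrightarrow> induces_ruled_isometries D F V \<longrightarrow> Q_net D V) \<and>
     (skew_transversals D C \<longrightarrow> induces_ruled_isometries D C C' \<longrightarrow> Q_net D C')"
proof -
  note U = \<open>open U\<close> and D = \<open>open D\<close>
  have \<psi>: "smooth_on D \<psi>" and \<psi>U: "\<psi> ` D \<subseteq> U" and f: "smooth_on U f" and n: "smooth_on U n"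
    and c: "smooth_on U c"
    by fact+
  define \<nu> where "\<nu> = (\<lambda>q. gradient n (\<psi> q))"
  define h where "h = (\<lambda>q. hess_form n (\<psi> q) (pd1 \<psi> q) (pd2 \<psi> q))"

  have F_eq: "F = (\<lambda>q. (fst (\<psi> q), snd (\<psi> q), f (\<psi> q)))"
    unfolding assms(11) by (auto simp: graph_surface_def split: prod.split)
  have V_eq: "V = (\<lambda>q. (- snd (\<psi> q), fst (\<psi> q), n (\<psi> q)))"
    unfolding assms(12) by (auto simp: velocity_diagram_def split: prod.split)
  have C_eq: "C = (\<lambda>q. (- fst (\<nu> q), - snd (\<nu> q), c (\<psi> q)))"
    unfolding assms(13) by (auto simp: rotation_diagram_def \<nu>_def gradient_def)
  have C'_eq: "C' = (\<lambda>q. (- snd (\<nu> q), fst (\<nu> q), - n (\<psi> q) + \<nu> q \<bullet> \<psi> q))"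
    unfolding assms(14)
    by (auto simp: translation_diagram_def \<nu>_def gradient_def inner_prod_def split: prod.split)

  note comp = smooth_on_compose[OF D \<psi> \<psi>U]
  have \<nu>: "smooth_on D \<nu>"
    unfolding \<nu>_def gradient_def
    by (intro smooth_on_Pair D comp[OF smooth_on_pd(1)[OF n]] comp[OF smooth_on_pd(2)[OF n]])
  have n\<psi>: "smooth_on D (\<lambda>q. n (\<psi> q))"
    by (rule comp[OF n])
  have F: "smooth_on D F" and V: "smooth_on D V" and C: "smooth_on D C"
    unfolding F_eq V_eq C_eq
    by (intro smooth_on_intros D \<psi> \<nu> comp[OF f] n\<psi> comp[OF c])+
  have C': "smooth_on D C'"
    unfolding C'_eq
    by (intro smooth_on_Pair smooth_on_add smooth_on_uminus smooth_on_fst_snd D \<psi> \<nu> n\<psi>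
        smooth_on_bilinear[OF D bounded_bilinear_inner])

  have top: "top_view (F q) = \<psi> q" "top_view (V q) = rot90 (\<psi> q)"
    "top_view (C q) = - \<nu> q" "top_view (C' q) = rot90 (\<nu> q)" for q
    by (auto simp: F_eq V_eq C_eq C'_eq top_view_height_simps rot90_def prod_eq_iff split: prod.split)
  have ht: "height (F q) = f (\<psi> q)" "height (V q) = n (\<psi> q)"
    "height (C q) = c (\<psi> q)" "height (C' q) = - n (\<psi> q) + \<nu> q \<bullet> \<psi> q" for q
    by (simp_all add: F_eq V_eq C_eq C'_eq top_view_height_simps)
  have \<psi>q: "\<psi> q \<in> U" if "q \<in> D" for q
    using that \<psi>U by blast
  have d: "\<psi> differentiable (at q)" "\<nu> differentiable (at q)" "F differentiable (at q)"
    "C differentiable (at q)" "pd1 \<nu> differentiable (at q)" if "q \<in> D" for q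
    using that smooth_on_differentiable \<psi> \<nu> F C smooth_on_pd(1)[OF \<nu>] by blast+
  have dU: "f differentiable (at (\<psi> q))" "n differentiable (at (\<psi> q))"
    "c differentiable (at (\<psi> q))" if "q \<in> D" for q
    using \<psi>q[OF that] smooth_on_differentiable f n c by blast+

  have det\<psi>: "det2 (pd1 \<psi> q) (pd2 \<psi> q) \<noteq> 0" if q: "q \<in> D" for q
  proof -
    have "top_regular F q" using assms(15) q by blast
    then show ?thesis
      by (simp add: top_regular_det2[OF d(3)[OF q]] pd_top_view_height[OF d(3)[OF q]] top)
  qed
  have det\<nu>: "det2 (pd1 \<nu> q) (pd2 \<nu> q) \<noteq> 0" if q: "q \<in> D" for q
  proof -
    have "top_regular C q" using assms(16) q by blast
    moreover have "pd1 (\<lambda>q. - \<nu> q) q = - pd1 \<nu> q" "pd2 (\<lambda>q. - \<nu> q) q = - pd2 \<nu> q"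
      using pd_linear[OF bounded_linear_minus[OF bounded_linear_ident] d(2)[OF q]] by simp_all
    ultimately show ?thesis
      by (simp add: top_regular_det2[OF d(4)[OF q]] pd_top_view_height[OF d(4)[OF q]] top det2_def)
  qed

  have n\<psi>_pd: "pd1 (\<lambda>q. n (\<psi> q)) q = \<nu> q \<bullet> pd1 \<psi> q" "pd2 (\<lambda>q. n (\<psi> q)) q = \<nu> q \<bullet> pd2 \<psi> q"
    if "q \<in> D" for q
    unfolding \<nu>_def using pd_compose_gradient[OF d(1)[OF that] dU(2)[OF that]] .
  have \<nu>_pd: "pd1 \<nu> q \<bullet> b = hess_form n (\<psi> q) (pd1 \<psi> q) b"
    "pd2 \<nu> q \<bullet> b = hess_form n (\<psi> q) (pd2 \<psi> q) b" if "q \<in> D" for q b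
    unfolding \<nu>_def
    using pd_gradient_compose(2,3)[OF U smooth_on_imp_Ck_on[OF n] \<psi>q[OF that] d(1)[OF that]] .

  \<comment> \<open>The height of \<open>V\<close> is \<open>n \<circ> \<psi>\<close>, with first derivatives \<open>\<nu> \<bullet> \<psi>\<^sub>u\<close> and \<open>\<nu> \<bullet> \<psi>\<^sub>v\<close>.\<close>
  have QV: "Q_net D V \<longleftrightarrow> (\<forall>q\<in>D. h q = 0)"
  proof (rule Q_net_over_rotated_top[OF D V \<psi> top(2) det\<psi>, where w = \<nu>])
    fix q assume q: "q \<in> D"
    show "pd1 (\<lambda>q. height (V q)) q = \<nu> q \<bullet> pd1 \<psi> q" "pd2 (\<lambda>q. height (V q)) q = \<nu> q \<bullet> pd2 \<psi> q"
      unfolding ht using n\<psi>_pd[OF q] .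
    show "pd2 (pd1 (\<lambda>q. height (V q))) q = h q + \<nu> q \<bullet> pd2 (pd1 \<psi>) q"
      unfolding ht h_def \<nu>_def
      by (rule pd_pd_compose(2)[OF D q smooth_on_imp_Ck_on[OF \<psi>] U smooth_on_imp_Ck_on[OF n] \<psi>U])
  qed

  \<comment> \<open>The height of \<open>C'\<close> is the Legendre transform of \<open>n\<close>: on differentiation, the terms with
    derivatives of \<open>\<psi>\<close> cancel.\<close>
  have QC': "Q_net D C' \<longleftrightarrow> (\<forall>q\<in>D. h q = 0)"
  proof (rule Q_net_over_rotated_top[OF D C' \<nu> top(4) det\<nu>, where w = \<psi>])
    have first: "pd1 (\<lambda>q. height (C' q)) q = \<psi> q \<bullet> pd1 \<nu> q"
      "pd2 (\<lambda>q. height (C' q)) q = \<psi> q \<bullet> pd2 \<nu> q" if q: "q \<in> D" for q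
    proof -
      have inner: "(\<lambda>q. \<nu> q \<bullet> \<psi> q) differentiable (at q)"
        using bounded_bilinear.FDERIV[OF bounded_bilinear_inner
            has_derivative_pd[OF d(2)[OF q]] has_derivative_pd[OF d(1)[OF q]]]
        unfolding differentiable_def by blast
      have minus: "(\<lambda>q. - n (\<psi> q)) differentiable (at q)"
        using smooth_on_differentiable[OF smooth_on_uminus[OF D n\<psi>] q] .
      note lin = pd_linear[OF bounded_linear_minus[OF bounded_linear_ident]
          smooth_on_differentiable[OF n\<psi> q]]
      show "pd1 (\<lambda>q. height (C' q)) q = \<psi> q \<bullet> pd1 \<nu> q"
        "pd2 (\<lambda>q. height (C' q)) q = \<psi> q \<bullet> pd2 \<nu> q"
        unfolding ht pd_add[OF minus inner] lin n\<psi>_pd[OF q]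
          pd_bilinear[OF bounded_bilinear_inner d(2)[OF q] d(1)[OF q]]
        by (simp_all add: inner_commute)
    qed
    fix q assume q: "q \<in> D"
    show "pd1 (\<lambda>q. height (C' q)) q = \<psi> q \<bullet> pd1 \<nu> q" "pd2 (\<lambda>q. height (C' q)) q = \<psi> q \<bullet> pd2 \<nu> q"
      using first[OF q] .
    have "pd2 (pd1 (\<lambda>q. height (C' q))) q = pd2 (\<lambda>q. \<psi> q \<bullet> pd1 \<nu> q) q"
      by (rule pd_cong(2)[OF D q first(1)])
    then show "pd2 (pd1 (\<lambda>q. height (C' q))) q = h q + \<psi> q \<bullet> pd2 (pd1 \<nu>) q"
      unfolding pd_bilinear(2)[OF bounded_bilinear_inner d(1)[OF q] d(5)[OF q]]
      using \<nu>_pd(1)[OF q, of "pd2 \<psi> q"] by (simp add: h_def inner_commute)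
  qed

  \<comment> \<open>The differential equations for \<open>c\<close> say that \<open>LC\<close> has its tangent vectors in the tangent planes
    of the graph of \<open>f\<close>, just as \<open>F\<close> has.\<close>
  have RP: "reciprocal_parallel D (motion_L \<circ> C) F \<longleftrightarrow> (\<forall>q\<in>D. h q = 0)"
  proof -
    define H where "H = motion_L \<circ> C"
    have H_eq: "H = (\<lambda>q. (- snd (\<nu> q), fst (\<nu> q), - c (\<psi> q)))"
      by (auto simp: H_def motion_L_def C_eq)
    have smooth_H: "smooth_on D H"
      unfolding H_eq by (intro smooth_on_intros D \<nu> comp[OF c])
    have "collinear {0, pd1 H q, pd2 F q} \<longleftrightarrow> h q = 0"
      "collinear {0, pd2 H q, pd1 F q} \<longleftrightarrow> h q = 0" if q: "q \<in> D" for q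
    proof -
      have dH: "H differentiable (at q)"
        using smooth_on_differentiable[OF smooth_H q] .
      have topH: "top_view (H q) = 1 *\<^sub>R rot90 (\<nu> q)" and htH: "height (H q) = - c (\<psi> q)" for q
        by (auto simp: H_eq top_view_height_simps rot90_def split: prod.split)
      note R = bounded_linear_scaleR_rot90[of 1]
      have t: "top_view (pd1 H q) = rot90 (pd1 \<nu> q)" "top_view (pd2 H q) = rot90 (pd2 \<nu> q)"
        using pd_linear[OF R d(2)[OF q]] by (simp_all add: pd_top_view_height[OF dH] topH)
      have tF: "top_view (pd1 F q) = pd1 \<psi> q" "top_view (pd2 F q) = pd2 \<psi> q"
        by (simp_all add: pd_top_view_height[OF d(3)[OF q]] top)
      have "fst (gradient c (\<psi> q)) = fst (gradient f (\<psi> q)) * pd2 (pd1 n) (\<psi> q)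
          - snd (gradient f (\<psi> q)) * pd1 (pd1 n) (\<psi> q)"
        "snd (gradient c (\<psi> q)) = fst (gradient f (\<psi> q)) * pd2 (pd2 n) (\<psi> q)
          - snd (gradient f (\<psi> q)) * pd2 (pd1 n) (\<psi> q)"
        using assms(7) \<psi>q[OF q] by (simp_all add: rotation_height_def gradient_def)
      note grad_c = this
      have grad: "gradient c (\<psi> q) \<bullet> b
          = fst (gradient f (\<psi> q)) * hess_form n (\<psi> q) b (0, 1)
            - snd (gradient f (\<psi> q)) * hess_form n (\<psi> q) b (1, 0)" for b
        unfolding inner_prod_def grad_c by (simp add: hess_form_def algebra_simps)
      have "height (pd1 H q) = - (gradient c (\<psi> q) \<bullet> pd1 \<psi> q)"
        "height (pd2 H q) = - (gradient c (\<psi> q) \<bullet> pd2 \<psi> q)"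
        using pd_linear[OF bounded_linear_minus[OF bounded_linear_ident]
            smooth_on_differentiable[OF comp[OF c] q]]
          pd_compose_gradient[OF d(1)[OF q] dU(3)[OF q]]
        by (simp_all add: pd_top_view_height[OF dH] htH)
      then have hH: "height (pd1 H q) = gradient f (\<psi> q) \<bullet> top_view (pd1 H q)"
        "height (pd2 H q) = gradient f (\<psi> q) \<bullet> top_view (pd2 H q)"
        unfolding grad \<nu>_pd[OF q, symmetric] t
        by (simp_all add: rot90_def inner_prod_def split: prod.split)
      have hF: "height (pd1 F q) = gradient f (\<psi> q) \<bullet> top_view (pd1 F q)"
        "height (pd2 F q) = gradient f (\<psi> q) \<bullet> top_view (pd2 F q)"
        unfolding tF pd_top_view_height[OF d(3)[OF q]] ht
        by (rule pd_compose_gradient[OF d(1)[OF q] dU(1)[OF q]])+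
      have nz: "top_view (pd1 F q) \<noteq> 0" "top_view (pd2 F q) \<noteq> 0"
        unfolding tF using det\<psi>[OF q] by (auto simp: det2_def)
      show "collinear {0, pd1 H q, pd2 F q} \<longleftrightarrow> h q = 0"
        unfolding collinear_in_plane_iff[OF hH(1) hF(2) nz(2)] t tF det2_rot90(2) \<nu>_pd[OF q] h_def
        by simp
      show "collinear {0, pd2 H q, pd1 F q} \<longleftrightarrow> h q = 0"
        unfolding collinear_in_plane_iff[OF hH(2) hF(1) nz(1)] t tF det2_rot90(2) \<nu>_pd[OF q] h_def
        by (simp add: hess_form_commute[of _ _ "pd2 \<psi> q"])
    qed
    then show ?thesis by (simp add: reciprocal_parallel_def H_def[symmetric])
  qed

  have rotF: "rotated_top 1 (F q) (V q)" and rotC: "rotated_top (- 1) (C q) (C' q)" for q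
    by (simp_all add: rotated_top_def top) (simp add: rot90_def split: prod.split)
  have FV: "Q_net D V \<Longrightarrow> induces_ruled_isometries D F V"
    "skew_transversals D F \<Longrightarrow> induces_ruled_isometries D F V \<Longrightarrow> Q_net D V"
    by (rule Q_net_and_induced_isometries[OF _ D F V rotF]; use assms(15) in simp)+
  have CC': "Q_net D C' \<Longrightarrow> induces_ruled_isometries D C C'"
    "skew_transversals D C \<Longrightarrow> induces_ruled_isometries D C C' \<Longrightarrow> Q_net D C'"
    by (rule Q_net_and_induced_isometries[OF _ D C C' rotC]; use assms(16) in simp)+
  show ?thesis
    using QV QC' RP FV CC' by blast
qed

end
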